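(* Let $G$ be a countably infinite discrete group acting by homeomorphisms on a compact metric space $X$, let $\mu\in\mathcal{M}(X,G)$ and let $K\in\mathbb{N}$ with $K\ge2$. If $(X,G)$ has no essential sequence entropy $K$-tuples for $\mu$, then $h_\mu^*(G)\le\log(K-1)$.
   Context: $\mathcal{M}(X,G)$ is the set of $G$-invariant Borel probability measures on $X$. $\mathcal{B}_X^\mu$ is the $\mu$-completion of the Borel $\sigma$-algebra, and $\mathcal{P}_X^\mu$ is the set of finite families $\alpha$ of pairwise disjoint sets in $\mathcal{B}_X^\mu$ whose union has full $\mu$-measure. $H_\mu(\alpha)=-\sum_{A\in\alpha}\mu(A)\log\mu(A)$. For a sequence $\mathcal{A}=\{g_i\}_{i\in\mathbb{N}}$ in $G$, $h_\mu^{\mathcal{A}}(G,\alpha)=\limsup_{n\to\infty}\frac1n H_\mu(\bigvee_{i=1}^n g_i^{-1}\alpha)$; $h_\mu^*(G,\alpha)=\sup_{\mathcal{A}}h_\mu^{\mathcal{A}}(G,\alpha)$ over all sequences in $G$; and $h_\mu^*(G)=\sup_{\alpha\in\mathcal{P}_X^\mu}h_\mu^*(G,\alpha)$. $\Delta_K(X)=\{(x,\ldots,x)\in X^{(K)}:x\in X\}$, where $X^{(K)}$ is the $K$-fold product. A partition $\{A_1,\ldots,A_L\}\in\mathcal{P}_X^\mu$ is admissible with respect to $(x_1,\ldots,x_K)$ if for each $1\le l\le L$ there is $1\le k_l\le K$ with $x_{k_l}\notin\overline{A_l}$. A tuple $(x_1,\ldots,x_K)\in X^{(K)}\setminus\Delta_K(X)$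 is a sequence entropy $K$-tuple for $\mu$ if $h_\mu^*(G,\alpha)>0$ for every $\alpha\in\mathcal{P}_X^\mu$ admissible with respect to it. A $K$-tuple is essential if $x_i\neq x_j$ for all $1\le i<j\le K$. *)

theory Defs
  imports "HOL-Probability.Probability" "HOL-Algebra.Group_Action"
begin

text \<open>
  The space \<open>X\<close> is the whole type \<open>'x\<close>; the group \<open>G\<close> acts on it through
  \<open>\<phi>\<close>, with \<open>\<phi> g x\<close> standing for \<open>g x\<close>.
\<close>

definition action_by_homeomorphisms ::
  "('g, 'm) monoid_scheme \<Rightarrow> ('g \<Rightarrow> 'x::topological_space \<Rightarrow> 'x) \<Rightarrow> bool" where
  "action_by_homeomorphisms G \<phi> \<longleftrightarrow>
     group_action G UNIV \<phi> \<and> (\<forall>g\<in>carrier G. homeomorphic_map euclidean euclidean (\<phi> g))"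

definition invariant_measures ::
  "('g, 'm) monoid_scheme \<Rightarrow> ('g \<Rightarrow> 'x::topological_space \<Rightarrow> 'x) \<Rightarrow> 'x measure set" where
  "invariant_measures G \<phi> =
     {\<mu>. prob_space \<mu> \<and> sets \<mu> = sets borel \<and>
         (\<forall>g\<in>carrier G. \<forall>A\<in>sets borel. emeasure \<mu> (\<phi> g -` A) = emeasure \<mu> A)}"

text \<open>
  The measure \<open>\<mu>\<close> lives on the Borel sets; its extension to the \<open>\<mu>\<close>-completion is
  \<open>completion \<mu>\<close>.
\<close>

definition measurable_partitions :: "'x measure \<Rightarrow> 'x set set set" where
  "measurable_partitions \<mu> =
     {\<alpha>. finite \<alpha> \<and> \<alpha> \<subseteq> sets (completion \<mu>) \<and> disjoint \<alpha> \<and>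
         emeasure (completion \<mu>) (\<Union>\<alpha>) = emeasure (completion \<mu>) (space \<mu>)}"

text \<open>The convention \<open>0 log 0 = 0\<close> is automatic, since \<open>0 * ln 0 = 0\<close> here.\<close>

definition partition_entropy :: "'x measure \<Rightarrow> 'x set set \<Rightarrow> real" where
  "partition_entropy \<mu> \<alpha> =
     - (\<Sum>A\<in>\<alpha>. measure (completion \<mu>) A * ln (measure (completion \<mu>) A))"

text \<open>
  As a set of sets, the join does not record how often the empty set occurs among the
  intersections; the nonempty ones are distinct when each \<open>P i\<close> is disjoint.
\<close>

definition partition_join :: "'i set \<Rightarrow> ('i \<Rightarrow> 'x set set) \<Rightarrow> 'x set set" where
  "partition_join I P = (\<lambda>s. \<Inter>i\<in>I. s i) ` (Pi\<^sub>E I P)"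

definition seq_entropy_along ::
  "('g \<Rightarrow> 'x \<Rightarrow> 'x) \<Rightarrow> 'x measure \<Rightarrow> (nat \<Rightarrow> 'g) \<Rightarrow> 'x set set \<Rightarrow> ereal" where
  "seq_entropy_along \<phi> \<mu> g \<alpha> =
     limsup (\<lambda>n. ereal (1 / real n *
       partition_entropy \<mu> (partition_join {1..n} (\<lambda>i. (\<lambda>A. \<phi> (g i) -` A) ` \<alpha>))))"

definition max_seq_entropy_partition ::
  "('g, 'm) monoid_scheme \<Rightarrow> ('g \<Rightarrow> 'x \<Rightarrow> 'x) \<Rightarrow> 'x measure \<Rightarrow> 'x set set \<Rightarrow> ereal" where
  "max_seq_entropy_partition G \<phi> \<mu> \<alpha> =
     (SUP g\<in>{g. range g \<subseteq> carrier G}. seq_entropy_along \<phi> \<mu> g \<alpha>)"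

definition max_seq_entropy ::
  "('g, 'm) monoid_scheme \<Rightarrow> ('g \<Rightarrow> 'x \<Rightarrow> 'x) \<Rightarrow> 'x measure \<Rightarrow> ereal" where
  "max_seq_entropy G \<phi> \<mu> = (SUP \<alpha>\<in>measurable_partitions \<mu>. max_seq_entropy_partition G \<phi> \<mu> \<alpha>)"

text \<open>A \<open>K\<close>-tuple is an extensional function on the index set \<open>{1..K}\<close>.\<close>

definition tuples :: "nat \<Rightarrow> (nat \<Rightarrow> 'x) set" where
  "tuples K = {1..K} \<rightarrow>\<^sub>E UNIV"

definition diagonal_tuples :: "nat \<Rightarrow> (nat \<Rightarrow> 'x) set" where
  "diagonal_tuples K = {\<lambda>k\<in>{1..K}. y | y. True}"

definition admissible ::
  "'x::topological_space measure \<Rightarrow> nat \<Rightarrow> (nat \<Rightarrow> 'x) \<Rightarrow> 'x set set \<Rightarrow> bool" where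
  "admissible \<mu> K x \<alpha> \<longleftrightarrow>
     \<alpha> \<in> measurable_partitions \<mu> \<and> (\<forall>A\<in>\<alpha>. \<exists>k\<in>{1..K}. x k \<notin> closure A)"

definition seq_entropy_tuple ::
  "('g, 'm) monoid_scheme \<Rightarrow> ('g \<Rightarrow> 'x::topological_space \<Rightarrow> 'x) \<Rightarrow> 'x measure \<Rightarrow>
    nat \<Rightarrow> (nat \<Rightarrow> 'x) \<Rightarrow> bool" where
  "seq_entropy_tuple G \<phi> \<mu> K x \<longleftrightarrow>
     x \<in> tuples K - diagonal_tuples K \<and>
     (\<forall>\<alpha>. admissible \<mu> K x \<alpha> \<longrightarrow> max_seq_entropy_partition G \<phi> \<mu> \<alpha> > 0)"

definition essential_tuple :: "nat \<Rightarrow> (nat \<Rightarrow> 'x) \<Rightarrow> bool" where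
  "essential_tuple K x \<longleftrightarrow> (\<forall>i j. 1 \<le> i \<and> i < j \<and> j \<le> K \<longrightarrow> x i \<noteq> x j)"

end

theory Submission
  imports Defs
begin

text \<open>
  Call a set almost periodic if its orbit is totally bounded for the distance
  \<open>\<mu>(A \<triangle> B)\<close>; these sets form the Kronecker \<open>\<sigma>\<close>-algebra. A greedy choice of the sequence
  shows that a partition without positive sequence entropy consists of almost periodic sets, and
  along any sequence a finite family of almost periodic sets generates sublinear entropy. So the
  theorem follows once, for every finite partition \<open>\<alpha>\<close>, there is a finite partition into almost
  periodic sets each of which meets at most \<open>K - 1\<close> members of \<open>\<alpha>\<close> in positive measure.

  If there are no essential sequence entropy tuples, every tuple of \<open>K\<close> distinct points has an
  admissible partition into almost periodic sets, which provides neighbourhoods \<open>U\<^sub>1, \<dots>, U\<^sub>K\<close> and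
  almost periodic sets \<open>E\<^sub>1, \<dots>, E\<^sub>K\<close> covering almost everything with \<open>U\<^sub>k \<inter> E\<^sub>k\<close> null. This
  separation property is preserved under countable unions in each coordinate, so compactness of the
  product extends it from neighbourhoods to disjoint closed sets, and regularity of \<open>\<mu>\<close> to
  disjoint measurable sets, in particular to any \<open>K\<close> members of \<open>\<alpha>\<close>.
\<close>

section \<open>Entropy of simple functions\<close>

lemma restrict_eq_iff: "restrict f I = restrict g I \<longleftrightarrow> (\<forall>i\<in>I. f i = g i)"
  by (auto simp: fun_eq_iff restrict_def)

context information_space
begin

lemma entropy_simple_function:
  assumes "simple_function M X"
  shows "\<H>(X) = - (\<Sum>v\<in>X ` space M. prob (X -` {v} \<inter> space M) * log b (prob (X -` {v} \<inter> space M)))"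
  by (rule entropy_simple_distributed[OF simple_distributedI[OF assms measure_nonneg refl]])

lemma entropy_nonneg:
  assumes "simple_function M X"
  shows "\<H>(X) \<ge> 0"
  using conditional_entropy_nonneg[OF assms assms] conditional_entropy_less_eq_entropy[OF assms assms]
  by linarith

lemma entropy_Pair_le:
  assumes "simple_function M X" "simple_function M Y"
  shows "\<H>(\<lambda>x. (X x, Y x)) \<le> \<H>(X) + \<H>(Y)"
  using entropy_chain_rule[OF assms] conditional_entropy_less_eq_entropy[OF assms(2,1)] by simp

text \<open>Supplies the factor map that \<open>entropy_data_processing\<close> asks for; its values
  off the range of \<open>Y\<close> are arbitrary. Orbit tuples can then be compared through their
  fibres, without naming such a map.\<close>

lemma factorization:
  assumes "\<And>x y. Y x = Y y \<Longrightarrow> X x = X y"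
  obtains f where "X = f \<circ> Y"
proof
  show "X = (\<lambda>v. X (SOME x. Y x = v)) \<circ> Y"
  proof
    fix x
    have "Y (SOME z. Y z = Y x) = Y x" by (rule someI) (rule refl)
    then show "X x = ((\<lambda>v. X (SOME x. Y x = v)) \<circ> Y) x"
      using assms by (metis comp_apply)
  qed
qed

lemma entropy_factor_le:
  assumes "simple_function M Y" "\<And>x y. Y x = Y y \<Longrightarrow> X x = X y"
  shows "\<H>(X) \<le> \<H>(Y)"
  using factorization[of Y X] assms entropy_data_processing by metis

lemma simple_function_factor:
  assumes "simple_function M Y" "\<And>x y. Y x = Y y \<Longrightarrow> X x = X y"
  shows "simple_function M X"
  using factorization[of Y X] assms simple_function_compose by metis

text \<open>Tuples over \<open>I\<close> are coded with \<open>restrict\<close>, so that two of them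
  agree exactly when all coordinates in \<open>I\<close> do. A nested pair that determines the tuple
  carries the induction.\<close>

lemma simple_function_tuple:
  assumes "finite I" "\<And>i. i \<in> I \<Longrightarrow> simple_function M (X i)"
  shows "simple_function M (\<lambda>x. \<lambda>i\<in>I. X i x)"
  using assms
proof (induction I)
  case (insert j I)
  have "simple_function M (\<lambda>x. (X j x, \<lambda>i\<in>I. X i x))"
    by (intro simple_function_Pair insert.IH insert.prems) auto
  then show ?case
  proof (rule simple_function_factor)
    fix x y assume "(X j x, \<lambda>i\<in>I. X i x) = (X j y, \<lambda>i\<in>I. X i y)"
    then show "(\<lambda>i\<in>insert j I. X i x) = (\<lambda>i\<in>insert j I. X i y)"
      by (auto simp: restrict_eq_iff)
  qed
qed (simp add: restrict_def)

lemma entropy_tuple_le: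
  assumes "finite I" "\<And>i. i \<in> I \<Longrightarrow> simple_function M (X i)"
  shows "\<H>(\<lambda>x. \<lambda>i\<in>I. X i x) \<le> (\<Sum>i\<in>I. \<H>(X i))"
  using assms
proof (induction I)
  case empty
  show ?case
    by (subst entropy_simple_function)
      (simp_all add: restrict_def not_empty image_constant_conv prob_space)
next
  case (insert j I)
  have sf: "simple_function M (\<lambda>x. \<lambda>i\<in>I. X i x)"
    by (intro simple_function_tuple insert.hyps insert.prems) auto
  have "\<H>(\<lambda>x. \<lambda>i\<in>insert j I. X i x) \<le> \<H>(\<lambda>x. (X j x, \<lambda>i\<in>I. X i x))"
  proof (rule entropy_factor_le)
    show "simple_function M (\<lambda>x. (X j x, \<lambda>i\<in>I. X i x))"
      by (intro simple_function_Pair sf insert.prems) auto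
    fix x y assume "(X j x, \<lambda>i\<in>I. X i x) = (X j y, \<lambda>i\<in>I. X i y)"
    then show "(\<lambda>i\<in>insert j I. X i x) = (\<lambda>i\<in>insert j I. X i y)"
      by (auto simp: restrict_eq_iff)
  qed
  also have "\<dots> \<le> \<H>(X j) + \<H>(\<lambda>x. \<lambda>i\<in>I. X i x)"
    by (intro entropy_Pair_le sf insert.prems) auto
  also have "\<dots> \<le> \<H>(X j) + (\<Sum>i\<in>I. \<H>(X i))"
    by (intro add_left_mono insert.IH insert.prems) auto
  finally show ?case unfolding sum.insert[OF insert.hyps] .
qed

section \<open>Conditional entropy, fibre by fibre\<close>

text \<open>Summing over all pairs of values, and not only over those attained jointly, adds terms
  of probability 0. The gain is an inner sum over one fibre of \<open>Y\<close> that can be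
  estimated on its own.\<close>

lemma conditional_entropy_simple_function:
  assumes X: "simple_function M X" and Y: "simple_function M Y"
  shows "\<H>(X | Y) = (\<Sum>v\<in>Y ` space M. \<Sum>u\<in>X ` space M.
    prob (X -` {u} \<inter> Y -` {v} \<inter> space M) *
      log b (prob (Y -` {v} \<inter> space M) / prob (X -` {u} \<inter> Y -` {v} \<inter> space M)))"
proof -
  let ?P = "\<lambda>u v. prob (X -` {u} \<inter> Y -` {v} \<inter> space M)"
  let ?Q = "\<lambda>v. prob (Y -` {v} \<inter> space M)"
  have fin: "finite (X ` space M)" "finite (Y ` space M)"
    using assms by (auto simp: simple_functionD)
  have eq: "(\<lambda>x. (X x, Y x)) -` {(u, v)} \<inter> space M = X -` {u} \<inter> Y -` {v} \<inter> space M" for u v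
    by auto
  have log: "- (?P u v * log b (?P u v / ?Q v)) = ?P u v * log b (?Q v / ?P u v)" for u v
    by (cases "?P u v = 0"; cases "?Q v = 0") (auto simp: log_def ln_div diff_divide_distrib algebra_simps)
  have "\<H>(X | Y) = - (\<Sum>(u, v)\<in>(\<lambda>x. (X x, Y x)) ` space M. ?P u v * log b (?P u v / ?Q v))"
    unfolding conditional_entropy_eq[OF simple_distributedI[OF Y measure_nonneg refl]
      simple_distributedI[OF simple_function_Pair[OF X Y] measure_nonneg refl]] eq ..
  also have "\<dots> = (\<Sum>(u, v)\<in>(\<lambda>x. (X x, Y x)) ` space M. ?P u v * log b (?Q v / ?P u v))"
    unfolding sum_negf[symmetric] by (intro sum.cong refl) (simp add: log split_beta)
  also have "\<dots> = (\<Sum>(u, v)\<in>X ` space M \<times> Y ` space M. ?P u v * log b (?Q v / ?P u v))"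
  proof (intro sum.mono_neutral_left ballI)
    fix p assume p: "p \<in> X ` space M \<times> Y ` space M - (\<lambda>x. (X x, Y x)) ` space M"
    obtain u v where uv: "p = (u, v)" by force
    have "X -` {u} \<inter> Y -` {v} \<inter> space M = {}"
    proof (rule ccontr)
      assume "X -` {u} \<inter> Y -` {v} \<inter> space M \<noteq> {}"
      then obtain x where "x \<in> space M" "X x = u" "Y x = v" by auto
      then have "p \<in> (\<lambda>x. (X x, Y x)) ` space M" unfolding uv by auto
      with p show False by simp
    qed
    then show "(case p of (u, v) \<Rightarrow> ?P u v * log b (?Q v / ?P u v)) = 0"
      unfolding uv by simp
  qed (use fin in auto)
  also have "\<dots> = (\<Sum>v\<in>Y ` space M. \<Sum>u\<in>X ` space M. ?P u v * log b (?Q v / ?P u v))"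
    by (subst sum.swap) (rule sum.cartesian_product[symmetric])
  finally show ?thesis .
qed

lemma sum_prob_fibres:
  assumes X: "simple_function M X" and A: "A \<in> events"
  shows "(\<Sum>u\<in>X ` space M. prob (X -` {u} \<inter> A)) = prob A"
proof -
  have "prob (\<Union>u\<in>X ` space M. X -` {u} \<inter> A) = (\<Sum>u\<in>X ` space M. prob (X -` {u} \<inter> A))"
  proof (rule finite_measure_finite_Union)
    show "(\<lambda>u. X -` {u} \<inter> A) ` X ` space M \<subseteq> events"
    proof safe
      fix x assume "x \<in> space M"
      have "(X -` {X x} \<inter> space M) \<inter> A \<in> events"
        using A simple_functionD(2)[OF X] by auto
      also have "(X -` {X x} \<inter> space M) \<inter> A = X -` {X x} \<inter> A"
        using sets.sets_into_space[OF A] by auto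
      finally show "X -` {X x} \<inter> A \<in> events" .
    qed
  qed (use simple_functionD(1)[OF X] in \<open>auto simp: disjoint_family_on_def\<close>)
  also have "(\<Union>u\<in>X ` space M. X -` {u} \<inter> A) = A"
    using sets.sets_into_space[OF A] by auto
  finally show ?thesis by simp
qed

lemma events_fibre:
  assumes "simple_function M X" "simple_function M Y"
  shows "X -` U \<inter> Y -` V \<inter> space M \<in> events"
proof -
  have "(X -` U \<inter> space M) \<inter> (Y -` V \<inter> space M) \<in> events"
    using assms by (auto dest: simple_functionD(2))
  also have "(X -` U \<inter> space M) \<inter> (Y -` V \<inter> space M) = X -` U \<inter> Y -` V \<inter> space M" by auto
  finally show ?thesis .
qed

text \<open>Gibbs' inequality against the uniform distribution on \<open>n\<close> values: a fibre
  of \<open>Y\<close> contributes at most its mass times \<open>log b n\<close>, and the masses of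
  the fibres sum to 1.\<close>

lemma conditional_entropy_le_log_card:
  assumes X: "simple_function M X" and Y: "simple_function M Y" and n: "n > 0"
    and card: "\<And>v. v \<in> Y ` space M \<Longrightarrow>
      card {u \<in> X ` space M. prob (X -` {u} \<inter> Y -` {v} \<inter> space M) > 0} \<le> n"
  shows "\<H>(X | Y) \<le> log b (real n)"
proof -
  let ?P = "\<lambda>u v. prob (X -` {u} \<inter> Y -` {v} \<inter> space M)"
  let ?Q = "\<lambda>v. prob (Y -` {v} \<inter> space M)"
  have fin: "finite (X ` space M)" "finite (Y ` space M)"
    using assms by (auto simp: simple_functionD)
  have lnb: "ln b > 0" using b_gt_1 by simp
  have PQ: "?P u v \<le> ?Q v" for u v
    using simple_functionD(2)[OF Y, of "{v}"] by (intro finite_measure_mono) auto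
  have sumP: "(\<Sum>u\<in>X ` space M. ?P u v) = ?Q v" for v
    using sum_prob_fibres[OF X simple_functionD(2)[OF Y, of "{v}"]]
    by (simp add: Int_assoc)
  have sumQ: "(\<Sum>v\<in>Y ` space M. ?Q v) = 1"
    using sum_prob_fibres[OF Y sets.top] by (simp add: prob_space)
  have inner: "(\<Sum>u\<in>X ` space M. ?P u v * log b (?Q v / ?P u v)) \<le> ?Q v * log b (real n)"
    if v: "v \<in> Y ` space M" for v
  proof -
    let ?S = "{u \<in> X ` space M. ?P u v > 0}"
    have fS: "finite ?S" using fin by auto
    have "(\<Sum>u\<in>X ` space M. ?P u v * log b (?Q v / ?P u v)) = (\<Sum>u\<in>?S. ?P u v * log b (?Q v / ?P u v))"
      using fin by (intro sum.mono_neutral_right) (auto simp: zero_less_measure_iff)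
    also have "\<dots> \<le> (\<Sum>u\<in>?S. ?P u v * log b (real n) + (?Q v / real n - ?P u v) / ln b)"
    proof (rule sum_mono)
      fix u assume "u \<in> ?S"
      then have P: "?P u v > 0" by simp
      then have Q: "?Q v > 0" using PQ[of u v] by linarith
      \<comment> \<open>Each value is compared with the uniform share \<open>?Q v / n\<close>, and
        \<open>ln t \<le> t - 1\<close> is applied to the ratio of this share to
        \<open>?P u v\<close>. The errors add up to at most 0 because \<open>?S\<close> has at most
        \<open>n\<close> elements.\<close>
      have "ln (?Q v / ?P u v) = ln (real n) + ln (?Q v / (real n * ?P u v))"
        using P Q n by (simp add: ln_div ln_mult)
      also have "\<dots> \<le> ln (real n) + (?Q v / (real n * ?P u v) - 1)"
        using P Q n by (intro add_left_mono ln_le_minus_one) auto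
      finally have "?P u v * ln (?Q v / ?P u v) \<le> ?P u v * (ln (real n) + (?Q v / (real n * ?P u v) - 1))"
        using P by (intro mult_left_mono) auto
      also have "\<dots> = ?P u v * ln (real n) + (?Q v / real n - ?P u v)"
        using P by (simp add: field_simps)
      finally have "?P u v * ln (?Q v / ?P u v) / ln b \<le> (?P u v * ln (real n) + (?Q v / real n - ?P u v)) / ln b"
        using lnb by (intro divide_right_mono) auto
      then show "?P u v * log b (?Q v / ?P u v) \<le> ?P u v * log b (real n) + (?Q v / real n - ?P u v) / ln b"
        by (simp add: log_def add_divide_distrib)
    qed
    also have "\<dots> = (\<Sum>u\<in>?S. ?P u v) * log b (real n) + (real (card ?S) * (?Q v / real n) - (\<Sum>u\<in>?S. ?P u v)) / ln b"
      by (simp add: sum.distrib sum_subtractf sum_distrib_right sum_divide_distrib[symmetric])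
    also have "(\<Sum>u\<in>?S. ?P u v) = ?Q v"
      unfolding sumP[symmetric] using fin
      by (intro sum.mono_neutral_left) (auto simp: zero_less_measure_iff)
    also have "real (card ?S) * (?Q v / real n) \<le> ?Q v"
    proof -
      have "real (card ?S) * (?Q v / real n) \<le> real n * (?Q v / real n)"
        using card[OF v] by (intro mult_right_mono) auto
      then show ?thesis using n by simp
    qed
    finally show ?thesis using lnb by (simp add: divide_right_mono)
  qed
  have "\<H>(X | Y) \<le> (\<Sum>v\<in>Y ` space M. ?Q v * log b (real n))"
    unfolding conditional_entropy_simple_function[OF X Y] by (rule sum_mono) (rule inner)
  also have "\<dots> = log b (real n)"
    using sumQ by (simp add: sum_distrib_right[symmetric])
  finally show ?thesis .
qed

lemma entropy_le_entropy_plus_log_card: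
  assumes X: "simple_function M X" and Y: "simple_function M Y" and n: "n > 0"
    and card: "\<And>v. v \<in> Y ` space M \<Longrightarrow>
      card {u \<in> X ` space M. prob (X -` {u} \<inter> Y -` {v} \<inter> space M) > 0} \<le> n"
  shows "\<H>(X) \<le> \<H>(Y) + log b (real n)"
proof -
  have "\<H>(X) \<le> \<H>(\<lambda>x. (Y x, X x))"
    using X Y by (intro entropy_factor_le simple_function_Pair) auto
  also have "\<dots> = \<H>(Y) + \<H>(X | Y)" by (rule entropy_chain_rule[OF Y X])
  finally show ?thesis using conditional_entropy_le_log_card[OF assms] by simp
qed

end

section \<open>Elementary estimates for \<open>p ln p\<close>\<close>

text \<open>The right-hand side is \<open>p + q\<close> times the binary entropy of
  \<open>p / (p + q)\<close>. By \<open>ln t \<le> t - 1\<close> it is at least the harmonic mean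
  \<open>2 * p * q / (p + q)\<close>, which dominates the smaller of \<open>p\<close> and
  \<open>q\<close>.\<close>

lemma min_le_sum_mult_ln:
  fixes p q :: real
  assumes "p \<ge> 0" "q \<ge> 0"
  shows "min p q \<le> p * ln ((p + q) / p) + q * ln ((p + q) / q)"
proof (cases "p = 0 \<or> q = 0")
  case False
  then have pq: "p > 0" "q > 0" using assms by auto
  have ge: "x * y / (x + y) \<le> x * ln ((x + y) / x)" if "x > 0" "y > 0" for x y :: real
  proof -
    have "ln (x / (x + y)) \<le> x / (x + y) - 1" using that by (intro ln_le_minus_one) auto
    then have "y / (x + y) \<le> ln ((x + y) / x)" using that by (simp add: ln_div field_simps)
    from mult_left_mono[OF this, of x] that show ?thesis by simp
  qed
  have "min p q * (p + q) \<le> 2 * p * q"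
    using pq by (auto simp: min_def algebra_simps mult_left_mono)
  then have "min p q \<le> 2 * p * q / (p + q)"
    using pq by (simp add: pos_le_divide_eq)
  also have "\<dots> = p * q / (p + q) + q * p / (q + p)"
    by (simp add: add.commute[of q p] mult.commute[of q p])
  also have "\<dots> \<le> p * ln ((p + q) / p) + q * ln ((q + p) / q)"
    by (intro add_mono ge pq)
  finally show ?thesis by (simp add: add.commute)
qed (use assms in auto)

lemma neg_mult_ln_le:
  fixes p :: real
  assumes "p \<ge> 0"
  shows "- (p * ln p) \<le> 1 - p"
proof (cases "p = 0")
  case False
  then have p: "p > 0" using assms by simp
  have "- ln p = ln (1 / p)" using p by (simp add: ln_div)
  also have "\<dots> \<le> 1 / p - 1" using p by (intro ln_le_minus_one) auto
  finally have "p * - ln p \<le> p * (1 / p - 1)" using p by (intro mult_left_mono) auto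
  then show ?thesis using p by (simp add: right_diff_distrib)
qed auto

text \<open>Applying \<open>neg_mult_ln_le\<close> to the square root of \<open>p\<close> leaves a
  factor that vanishes as \<open>p\<close> tends to 0. This is what makes events of small
  probability carry small entropy.\<close>

lemma neg_mult_ln_le_sqrt:
  fixes p :: real
  assumes "p \<ge> 0"
  shows "- (p * ln p) \<le> 2 * sqrt p"
proof -
  define r where "r = sqrt p"
  have r: "r \<ge> 0" "p = r ^ 2" using assms by (auto simp: r_def)
  have "- (p * ln p) = 2 * r * - (r * ln r)"
    unfolding r(2) by (cases "r = 0") (use r in \<open>auto simp: ln_mult power2_eq_square\<close>)
  also have "\<dots> \<le> 2 * r * (1 - r)"
    using r by (intro mult_left_mono neg_mult_ln_le) auto
  also have "\<dots> \<le> 2 * r"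
    using r by (simp add: algebra_simps)
  finally show ?thesis by (simp add: r_def)
qed

section \<open>Entropy of a single event\<close>

context information_space
begin

lemma simple_function_event:
  assumes "B \<in> events"
  shows "simple_function M (\<lambda>x. x \<in> B)"
  unfolding simple_function_def
proof (intro conjI ballI)
  fix v assume "v \<in> (\<lambda>x. x \<in> B) ` space M"
  have "(\<lambda>x. x \<in> B) -` {v} \<inter> space M = (if v then B \<inter> space M else space M - B)"
    by auto
  then show "(\<lambda>x. x \<in> B) -` {v} \<inter> space M \<in> events"
    using assms by auto
qed (rule finite_subset[of _ UNIV], auto)

text \<open>The two terms of the binary entropy get different bounds, each small when
  \<open>prob B\<close> is small: the square root bound for \<open>B\<close>, and
  \<open>neg_mult_ln_le\<close> for its complement.\<close>

lemma entropy_event_le: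
  assumes B: "B \<in> events"
  shows "\<H>(\<lambda>x. x \<in> B) \<le> (prob B + 2 * sqrt (prob B)) / ln b"
proof -
  let ?X = "\<lambda>x. x \<in> B"
  let ?f = "\<lambda>v. prob (?X -` {v} \<inter> space M) * log b (prob (?X -` {v} \<inter> space M))"
  have "?X -` {True} \<inter> space M = B" "?X -` {False} \<inter> space M = space M - B"
    using sets.sets_into_space[OF B] by auto
  then have p: "prob (?X -` {True} \<inter> space M) = prob B" "prob (?X -` {False} \<inter> space M) = 1 - prob B"
    using prob_compl[OF B] by auto
  have "\<H>(?X) = - sum ?f (?X ` space M)"
    by (rule entropy_simple_function[OF simple_function_event[OF B]])
  \<comment> \<open>If \<open>B\<close> is empty or everything, one truth value is not attained; its
    fibre is empty and contributes 0.\<close>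
  also have "sum ?f (?X ` space M) = sum ?f UNIV"
  proof (intro sum.mono_neutral_left ballI)
    fix v assume v: "v \<in> UNIV - ?X ` space M"
    then have "?X -` {v} \<inter> space M = {}" by blast
    then show "?f v = 0" by simp
  qed auto
  also have "- sum ?f UNIV = (- (prob B * ln (prob B)) - ((1 - prob B) * ln (1 - prob B))) / ln b"
    unfolding UNIV_bool by (simp add: p log_def add_divide_distrib diff_divide_distrib)
  also have "\<dots> \<le> (2 * sqrt (prob B) + prob B) / ln b"
    using neg_mult_ln_le_sqrt[of "prob B"] neg_mult_ln_le[of "1 - prob B"] b_gt_1
    by (intro divide_right_mono) (auto simp: prob_le_1)
  finally show ?thesis by (simp add: add.commute)
qed

text \<open>A Fano-type estimate. Membership in \<open>B\<close> is guessed on each fibre of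
  \<open>Y\<close> by majority; the error there is the smaller of two masses, which
  \<open>min_le_sum_mult_ln\<close> bounds by the share of that fibre in the conditional entropy.
  The factor \<open>ln b\<close> converts from base \<open>b\<close>.\<close>

lemma event_approximable_by_fibres:
  assumes B: "B \<in> events" and Y: "simple_function M Y"
  obtains V where "prob (sym_diff B (Y -` V \<inter> space M)) \<le> ln b * \<H>((\<lambda>x. x \<in> B) | Y)"
proof
  let ?X = "\<lambda>x. x \<in> B"
  have X: "simple_function M ?X" by (rule simple_function_event[OF B])
  let ?P = "\<lambda>u v. prob (?X -` {u} \<inter> Y -` {v} \<inter> space M)"
  let ?Q = "\<lambda>v. prob (Y -` {v} \<inter> space M)"
  define V where "V = {v. ?P False v \<le> ?P True v}"
  have ev: "?X -` {u} \<inter> Y -` {v} \<inter> space M \<in> events" for u v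
    by (rule events_fibre[OF X Y])
  have Q: "?Q v = ?P True v + ?P False v" for v
  proof -
    have "Y -` {v} \<inter> space M = (?X -` {True} \<inter> Y -` {v} \<inter> space M) \<union> (?X -` {False} \<inter> Y -` {v} \<inter> space M)"
      by auto
    also have "prob \<dots> = ?P True v + ?P False v"
      by (rule finite_measure_Union[OF ev ev]) auto
    finally show ?thesis .
  qed
  have D: "sym_diff B (Y -` V \<inter> space M) \<in> events"
    using B simple_functionD(2)[OF Y] by auto
  have fib: "prob (Y -` {v} \<inter> sym_diff B (Y -` V \<inter> space M)) = min (?P True v) (?P False v)" for v
  proof (cases "v \<in> V")
    case True
    then have "Y -` {v} \<inter> sym_diff B (Y -` V \<inter> space M) = ?X -` {False} \<inter> Y -` {v} \<inter> space M"
      using sets.sets_into_space[OF B] by auto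
    then show ?thesis using True by (simp add: V_def)
  next
    case False
    then have "Y -` {v} \<inter> sym_diff B (Y -` V \<inter> space M) = ?X -` {True} \<inter> Y -` {v} \<inter> space M"
      using sets.sets_into_space[OF B] by auto
    then show ?thesis using False by (simp add: V_def)
  qed
  have inner: "min (?P True v) (?P False v) \<le> ln b * (\<Sum>u\<in>?X ` space M. ?P u v * log b (?Q v / ?P u v))" for v
  proof -
    let ?f = "\<lambda>u. ?P u v * log b (?Q v / ?P u v)"
    have "sum ?f (?X ` space M) = sum ?f UNIV"
    proof (intro sum.mono_neutral_left ballI)
      fix u assume u: "u \<in> UNIV - ?X ` space M"
      then have "?X -` {u} \<inter> Y -` {v} \<inter> space M = {}" by blast
      then show "?f u = 0" by simp
    qed auto
    also have "ln b * \<dots> = ?P True v * ln (?Q v / ?P True v) + ?P False v * ln (?Q v / ?P False v)"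
      unfolding UNIV_bool using b_gt_1 by (simp add: log_def field_simps)
    finally show ?thesis
      using min_le_sum_mult_ln[of "?P True v" "?P False v"] by (simp add: Q)
  qed
  have "prob (sym_diff B (Y -` V \<inter> space M)) = (\<Sum>v\<in>Y ` space M. min (?P True v) (?P False v))"
    using sum_prob_fibres[OF Y D] unfolding fib by simp
  also have "\<dots> \<le> (\<Sum>v\<in>Y ` space M. ln b * (\<Sum>u\<in>?X ` space M. ?P u v * log b (?Q v / ?P u v)))"
    by (rule sum_mono) (rule inner)
  also have "\<dots> = ln b * \<H>(?X | Y)"
    unfolding conditional_entropy_simple_function[OF X Y] by (simp add: sum_distrib_left)
  finally show "prob (sym_diff B (Y -` V \<inter> space M)) \<le> ln b * \<H>(?X | Y)" .
qed

end

section \<open>Almost periodic sets\<close>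

text \<open>Instantiated later with the completed measure and the carrier of the group. As the space
  is the whole type, preimages need not be intersected with it.\<close>

locale measure_preserving_maps = prob_space M for M :: "'x measure" +
  fixes \<phi> :: "'g \<Rightarrow> 'x \<Rightarrow> 'x" and S :: "'g set"
  assumes space_UNIV: "space M = UNIV"
    and map_measurable: "g \<in> S \<Longrightarrow> \<phi> g \<in> M \<rightarrow>\<^sub>M M"
    and map_prob: "g \<in> S \<Longrightarrow> A \<in> events \<Longrightarrow> prob (\<phi> g -` A) = prob A"

text \<open>Base \<open>exp 1\<close> turns \<open>log\<close> into \<open>ln\<close>, in agreement
  with \<open>partition_entropy\<close>.\<close>

sublocale measure_preserving_maps \<subseteq> information_space M "exp 1"
  by unfold_locales simp

context measure_preserving_maps
begin

abbreviation entropy_ln (\<open>\<H>'(_')\<close>) where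
  "\<H>(X) \<equiv> entropy (exp 1) (count_space (X ` space M)) X"

lemma vimage_event: "g \<in> S \<Longrightarrow> A \<in> events \<Longrightarrow> \<phi> g -` A \<in> events"
  using measurable_sets[OF map_measurable] by (simp add: space_UNIV)

lemma Compl_event: "A \<in> events \<Longrightarrow> - A \<in> events"
  using sets.compl_sets[of A M] by (simp add: space_UNIV Compl_eq_Diff_UNIV)

lemma simple_function_map:
  assumes X: "simple_function M X" and g: "g \<in> S"
  shows "simple_function M (\<lambda>x. X (\<phi> g x))"
  unfolding simple_function_def
proof (intro conjI ballI)
  show "finite ((\<lambda>x. X (\<phi> g x)) ` space M)"
    using simple_functionD(1)[OF X] by (rule finite_subset[rotated]) (auto simp: space_UNIV)
  fix v
  have "X -` {v} \<in> events" using simple_functionD(2)[OF X, of "{v}"] by (simp add: space_UNIV)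
  from vimage_event[OF g this]
  show "(\<lambda>x. X (\<phi> g x)) -` {v} \<inter> space M \<in> events"
    by (simp add: space_UNIV vimage_def)
qed

lemma simple_function_orbit:
  assumes "simple_function M X" "finite I" "g ` I \<subseteq> S"
  shows "simple_function M (\<lambda>x. \<lambda>i\<in>I. X (\<phi> (g i) x))"
  using assms by (intro simple_function_tuple simple_function_map) auto

text \<open>
  The centres of the net may be arbitrary events, not just translates of \<open>B\<close>; this makes the
  approximation by unions of atoms in \<open>not_almost_periodic_entropy_growth\<close> usable directly.
\<close>

definition almost_periodic :: "'x set \<Rightarrow> bool" where
  "almost_periodic B \<longleftrightarrow> B \<in> events \<and> (\<forall>e>0. \<exists>F. finite F \<and> F \<subseteq> events \<and>
     (\<forall>g\<in>S. \<exists>C\<in>F. prob (sym_diff (\<phi> g -` B) C) < e))"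

section \<open>The almost periodic sets form a \<sigma>-algebra\<close>

lemma almost_periodic_event: "almost_periodic B \<Longrightarrow> B \<in> events"
  by (simp add: almost_periodic_def)

lemma almost_periodic_net:
  assumes "almost_periodic B" "e > 0"
  obtains F where "finite F" "F \<subseteq> events" "\<And>g. g \<in> S \<Longrightarrow> \<exists>C\<in>F. prob (sym_diff (\<phi> g -` B) C) < e"
proof -
  have "\<exists>F. finite F \<and> F \<subseteq> events \<and> (\<forall>g\<in>S. \<exists>C\<in>F. prob (sym_diff (\<phi> g -` B) C) < e)"
    using assms by (simp only: almost_periodic_def)
  then show thesis using that by (elim exE conjE) simp
qed

text \<open>A symmetric difference does not change when both sets are complemented, so complementing
  a net gives a net.\<close>

lemma almost_periodic_Compl:
  assumes "almost_periodic B"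
  shows "almost_periodic (- B)"
  unfolding almost_periodic_def
proof (intro conjI allI impI)
  show "- B \<in> events"
    by (rule Compl_event[OF almost_periodic_event[OF assms]])
  fix e :: real assume "e > 0"
  then obtain F where F: "finite F" "F \<subseteq> events"
      "\<And>g. g \<in> S \<Longrightarrow> \<exists>C\<in>F. prob (sym_diff (\<phi> g -` B) C) < e"
    using almost_periodic_net[OF assms] by metis
  show "\<exists>F. finite F \<and> F \<subseteq> events \<and> (\<forall>g\<in>S. \<exists>C\<in>F. prob (sym_diff (\<phi> g -` (- B)) C) < e)"
  proof (intro exI[of _ "uminus ` F"] conjI ballI)
    show "uminus ` F \<subseteq> events"
      using F(2) Compl_event by auto
    fix g assume "g \<in> S"
    then obtain C where C: "C \<in> F" "prob (sym_diff (\<phi> g -` B) C) < e" using F(3) by blast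
    have "sym_diff (\<phi> g -` (- B)) (- C) = sym_diff (\<phi> g -` B) C" by auto
    then show "\<exists>C\<in>uminus ` F. prob (sym_diff (\<phi> g -` (- B)) C) < e"
      using C by (intro bexI[of _ "- C"]) auto
  qed (use F in auto)
qed

text \<open>The union is approximated by its first \<open>n\<close> members with an error below
  \<open>e / 2\<close>, and this error is the same for all translates because the maps preserve the
  measure. The nets of the finitely many remaining sets are then combined.\<close>

lemma almost_periodic_UN:
  fixes B :: "nat \<Rightarrow> 'x set"
  assumes B: "\<And>n. almost_periodic (B n)"
  shows "almost_periodic (\<Union>n. B n)"
  unfolding almost_periodic_def
proof (intro conjI allI impI)
  note ev = almost_periodic_event[OF B]
  show U: "(\<Union>n. B n) \<in> events" using ev by auto
  fix e :: real assume e: "e > 0"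
  define V where "V n = (\<Union>i<n. B i)" for n
  have Vev: "V n \<in> events" for n unfolding V_def using ev by auto
  have "(\<lambda>n. prob (V n)) \<longlonglongrightarrow> prob (\<Union>n. V n)"
  proof (rule finite_Lim_measure_incseq)
    show "range V \<subseteq> events" using Vev by auto
    show "incseq V" unfolding V_def incseq_def by (meson UN_mono lessThan_subset_iff order_refl)
  qed
  moreover have "(\<Union>n. V n) = (\<Union>n. B n)" unfolding V_def by auto
  ultimately have "\<forall>\<^sub>F n in sequentially. prob (\<Union>n. B n) - e / 2 < prob (V n)"
    using e by (intro order_tendstoD(1)) auto
  then obtain n where n: "prob (\<Union>n. B n) - e / 2 < prob (V n)"
    unfolding eventually_sequentially by blast
  have tail: "prob ((\<Union>n. B n) - V n) < e / 2"
  proof -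
    have "V n \<subseteq> (\<Union>n. B n)" by (auto simp: V_def)
    then have "prob ((\<Union>n. B n) - V n) = prob (\<Union>n. B n) - prob (V n)"
      using U Vev by (intro finite_measure_Diff) auto
    then show ?thesis using n by linarith
  qed
  \<comment> \<open>Then \<open>n\<close> errors of size \<open>d\<close> add up to at most
    \<open>e / 2\<close>; the added 1 covers \<open>n = 0\<close>.\<close>
  define d where "d = e / (2 * (real n + 1))"
  have d: "d > 0" using e by (simp add: d_def)
  have "\<exists>F. finite F \<and> F \<subseteq> events \<and> (\<forall>g\<in>S. \<exists>C\<in>F. prob (sym_diff (\<phi> g -` B i) C) < d)" for i
    using B[of i] d by (simp only: almost_periodic_def)
  then obtain F where F: "\<And>i. finite (F i)" "\<And>i. F i \<subseteq> events"
      "\<And>i g. g \<in> S \<Longrightarrow> \<exists>C\<in>F i. prob (sym_diff (\<phi> g -` B i) C) < d"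
    by metis
  show "\<exists>F. finite F \<and> F \<subseteq> events \<and> (\<forall>g\<in>S. \<exists>C\<in>F. prob (sym_diff (\<phi> g -` (\<Union>n. B n)) C) < e)"
  \<comment> \<open>The centres are the unions formed from one centre per index, finitely many
    because the choice functions are extensional.\<close>
  proof (intro exI[of _ "(\<lambda>f. \<Union>i<n. f i) ` PiE {..<n} F"] conjI ballI)
    show "finite ((\<lambda>f. \<Union>i<n. f i) ` PiE {..<n} F)"
      using F(1) by (intro finite_imageI finite_PiE) auto
    show "(\<lambda>f. \<Union>i<n. f i) ` PiE {..<n} F \<subseteq> events"
    proof safe
      fix f assume "f \<in> PiE {..<n} F"
      then have "f i \<in> events" if "i < n" for i using that F(2) by (meson PiE_mem lessThan_iff subsetD)
      then show "(\<Union>i<n. f i) \<in> events" by (intro sets.finite_UN) auto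
    qed
    fix g assume g: "g \<in> S"
    obtain f where f: "\<And>i. f i \<in> F i" "\<And>i. prob (sym_diff (\<phi> g -` B i) (f i)) < d"
      using F(3)[OF g] by metis
    have fev: "f i \<in> events" for i using f(1) F(2) by blast
    have D: "sym_diff (\<phi> g -` B i) (f i) \<in> events" for i
      using vimage_event[OF g ev] fev by auto
    have T: "\<phi> g -` ((\<Union>n. B n) - V n) \<in> events"
      using U Vev by (intro vimage_event[OF g]) auto
    have "prob (sym_diff (\<phi> g -` (\<Union>n. B n)) (\<Union>i<n. f i))
        \<le> prob (\<phi> g -` ((\<Union>n. B n) - V n) \<union> (\<Union>i<n. sym_diff (\<phi> g -` B i) (f i)))"
    proof (rule finite_measure_mono)
      show "sym_diff (\<phi> g -` (\<Union>n. B n)) (\<Union>i<n. f i)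
          \<subseteq> \<phi> g -` ((\<Union>n. B n) - V n) \<union> (\<Union>i<n. sym_diff (\<phi> g -` B i) (f i))"
        unfolding V_def by blast
    qed (use D T in auto)
    also have "\<dots> \<le> prob (\<phi> g -` ((\<Union>n. B n) - V n)) + prob (\<Union>i<n. sym_diff (\<phi> g -` B i) (f i))"
      using D T by (intro measure_subadditive) (auto simp: fmeasurable_eq_sets)
    also have "\<dots> \<le> prob ((\<Union>n. B n) - V n) + (\<Sum>i<n. prob (sym_diff (\<phi> g -` B i) (f i)))"
      using D U Vev by (intro add_mono finite_measure_subadditive_finite) (auto simp: map_prob[OF g])
    also have "(\<Sum>i<n. prob (sym_diff (\<phi> g -` B i) (f i))) \<le> (\<Sum>i<n. d)"
      by (intro sum_mono less_imp_le f(2))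
    also have "(\<Sum>i<n. d) \<le> e / 2"
      using e by (simp add: d_def field_simps)
    finally have "prob (sym_diff (\<phi> g -` (\<Union>n. B n)) (\<Union>i<n. f i)) < e"
      using tail by linarith
    moreover have "(\<Union>i<n. f i) = (\<Union>i<n. restrict f {..<n} i)" by auto
    moreover have "restrict f {..<n} \<in> PiE {..<n} F" using f(1) by auto
    ultimately show "\<exists>C\<in>(\<lambda>f. \<Union>i<n. f i) ` PiE {..<n} F. prob (sym_diff (\<phi> g -` (\<Union>n. B n)) C) < e"
      by (metis (no_types, lifting) image_eqI)
  qed
qed

lemma almost_periodic_UNIV: "almost_periodic UNIV"
  unfolding almost_periodic_def
proof (intro conjI allI impI)
  show "UNIV \<in> events" using sets.top[of M] by (simp add: space_UNIV)
  fix e :: real assume "e > 0"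
  then show "\<exists>F. finite F \<and> F \<subseteq> events \<and> (\<forall>g\<in>S. \<exists>C\<in>F. prob (sym_diff (\<phi> g -` UNIV) C) < e)"
    using \<open>UNIV \<in> events\<close> by (intro exI[of _ "{UNIV}"]) auto
qed

lemma almost_periodic_empty: "almost_periodic {}"
  using almost_periodic_Compl[OF almost_periodic_UNIV] by simp

lemma almost_periodic_countable_UN:
  assumes "countable I" "\<And>i. i \<in> I \<Longrightarrow> almost_periodic (B i)"
  shows "almost_periodic (\<Union>i\<in>I. B i)"
proof (cases "I = {}")
  case False
  have "(\<Union>i\<in>I. B i) = (\<Union>n. B (from_nat_into I n))"
    using assms(1) False by (metis UN_extend_simps(10) range_from_nat_into)
  then show ?thesis
    using almost_periodic_UN assms(2) from_nat_into[OF False] by metis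
qed (simp add: almost_periodic_empty)

lemma almost_periodic_countable_INT:
  assumes "countable I" "\<And>i. i \<in> I \<Longrightarrow> almost_periodic (B i)"
  shows "almost_periodic (\<Inter>i\<in>I. B i)"
proof -
  have "(\<Inter>i\<in>I. B i) = - (\<Union>i\<in>I. - B i)" by auto
  then show ?thesis
    by (simp only:) (intro almost_periodic_Compl almost_periodic_countable_UN assms)
qed

end

section \<open>Entropy along a sequence of maps\<close>

context measure_preserving_maps
begin

text \<open>With a finite net fixed, the orbit pattern of \<open>B\<close> is determined by
  membership in the sets of the net, at a cost independent of \<open>I\<close>, and by membership in
  the small error sets, at a cost of at most \<open>e\<close> each.\<close>

lemma almost_periodic_entropy_growth_event:
  assumes B: "almost_periodic B" and e: "e > 0"
  obtains c where "\<And>(I :: nat set) g. finite I \<Longrightarrow> g ` I \<subseteq> S \<Longrightarrow>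
    \<H>(\<lambda>x. \<lambda>i\<in>I. \<phi> (g i) x \<in> B) \<le> c + real (card I) * e"
proof -
  \<comment> \<open>For \<open>p < d\<close> one has \<open>p \<le> sqrt p < e / 3\<close>, so the
    bound \<open>p + 2 * sqrt p\<close> of \<open>entropy_event_le\<close> stays below
    \<open>e\<close>.\<close>
  define d where "d = (e / 3)\<^sup>2"
  have d: "d > 0" using e by (simp add: d_def)
  obtain F where F: "finite F" "F \<subseteq> events" "\<And>g. g \<in> S \<Longrightarrow> \<exists>C\<in>F. prob (sym_diff (\<phi> g -` B) C) < d"
    using almost_periodic_net[OF B d] by metis
  define Y where "Y x = (\<lambda>C\<in>F. x \<in> C)" for x
  have Y: "simple_function M Y"
    unfolding Y_def by (intro simple_function_tuple simple_function_event) (use F in auto)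
  show thesis
  proof (rule that)
    fix I :: "nat set" and g :: "nat \<Rightarrow> 'g" assume I: "finite I" "g ` I \<subseteq> S"
    have "\<exists>C. C \<in> F \<and> prob (sym_diff (\<phi> (g i) -` B) C) < d" if "i \<in> I" for i
      using F(3)[of "g i"] I that by blast
    then obtain C where C: "\<And>i. i \<in> I \<Longrightarrow> C i \<in> F"
        "\<And>i. i \<in> I \<Longrightarrow> prob (sym_diff (\<phi> (g i) -` B) (C i)) < d"
      by metis
    define D where "D i = sym_diff (\<phi> (g i) -` B) (C i)" for i
    have Dev: "D i \<in> events" if "i \<in> I" for i
      unfolding D_def using vimage_event[OF _ almost_periodic_event[OF B], of "g i"] C(1)[OF that] F(2) I that
      by auto
    define Z where "Z x = (\<lambda>i\<in>I. x \<in> D i)" for x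
    have Z: "simple_function M Z"
      unfolding Z_def by (intro simple_function_tuple simple_function_event Dev I)
    have "\<H>(\<lambda>x. \<lambda>i\<in>I. \<phi> (g i) x \<in> B) \<le> \<H>(\<lambda>x. (Y x, Z x))"
    proof (rule entropy_factor_le[OF simple_function_Pair[OF Y Z]])
      fix x y assume "(Y x, Z x) = (Y y, Z y)"
      then have "\<forall>C\<in>F. x \<in> C \<longleftrightarrow> y \<in> C" "\<forall>i\<in>I. x \<in> D i \<longleftrightarrow> y \<in> D i"
        by (simp_all add: Y_def Z_def restrict_eq_iff)
      \<comment> \<open>Being in the translate of \<open>B\<close> is the exclusive or of being in
        \<open>C i\<close> and being in \<open>D i\<close>.\<close>
      then have "\<phi> (g i) x \<in> B \<longleftrightarrow> \<phi> (g i) y \<in> B" if "i \<in> I" for i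
        using C(1)[OF that] that unfolding D_def by blast
      then show "(\<lambda>i\<in>I. \<phi> (g i) x \<in> B) = (\<lambda>i\<in>I. \<phi> (g i) y \<in> B)"
        by (simp add: restrict_eq_iff)
    qed
    also have "\<dots> \<le> \<H>(Y) + \<H>(Z)" by (rule entropy_Pair_le[OF Y Z])
    also have "\<H>(Z) \<le> (\<Sum>i\<in>I. \<H>(\<lambda>x. x \<in> D i))"
      unfolding Z_def by (intro entropy_tuple_le simple_function_event Dev I)
    also have "\<dots> \<le> (\<Sum>i\<in>I. e)"
    proof (rule sum_mono)
      fix i assume i: "i \<in> I"
      have p: "prob (D i) \<le> sqrt (prob (D i))"
        by (rule real_le_rsqrt) (simp add: power2_eq_square mult_left_le)
      have "sqrt (prob (D i)) < sqrt d"
        using C(2)[OF i] by (simp add: D_def)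
      also have "sqrt d = e / 3" using e by (simp add: d_def)
      finally show "\<H>(\<lambda>x. x \<in> D i) \<le> e"
        using entropy_event_le[OF Dev[OF i]] p by simp
    qed
    finally show "\<H>(\<lambda>x. \<lambda>i\<in>I. \<phi> (g i) x \<in> B) \<le> \<H>(Y) + real (card I) * e" by simp
  qed
qed

text \<open>Transposing the tuple reduces the claim to subadditivity over \<open>J\<close>, with the
  rate \<open>e\<close> split evenly among the sets. The constant does not depend on the maps or on
  \<open>I\<close>.\<close>

lemma almost_periodic_entropy_growth:
  assumes J: "finite J" and B: "\<And>j. j \<in> J \<Longrightarrow> almost_periodic (B j)" and e: "e > 0"
  obtains c where "\<And>(I :: nat set) g. finite I \<Longrightarrow> g ` I \<subseteq> S \<Longrightarrow>
    \<H>(\<lambda>x. \<lambda>i\<in>I. \<lambda>j\<in>J. \<phi> (g i) x \<in> B j) \<le> c + real (card I) * e"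
proof -
  define d where "d = e / (real (card J) + 1)"
  have d: "d > 0" using e by (simp add: d_def)
  have "\<exists>c. \<forall>(I :: nat set) g. finite I \<longrightarrow> g ` I \<subseteq> S \<longrightarrow>
      \<H>(\<lambda>x. \<lambda>i\<in>I. \<phi> (g i) x \<in> B j) \<le> c + real (card I) * d" if "j \<in> J" for j
    using almost_periodic_entropy_growth_event[OF B[OF that] d] by metis
  then obtain c where c: "\<And>j (I :: nat set) g. j \<in> J \<Longrightarrow> finite I \<Longrightarrow> g ` I \<subseteq> S \<Longrightarrow>
      \<H>(\<lambda>x. \<lambda>i\<in>I. \<phi> (g i) x \<in> B j) \<le> c j + real (card I) * d"
    by metis
  show thesis
  proof (rule that)
    fix I :: "nat set" and g :: "nat \<Rightarrow> 'g" assume I: "finite I" "g ` I \<subseteq> S"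
    have sf: "simple_function M (\<lambda>x. \<lambda>i\<in>I. \<phi> (g i) x \<in> B j)" if "j \<in> J" for j
      using simple_function_orbit[OF simple_function_event[OF almost_periodic_event[OF B[OF that]]] I] .
    have "\<H>(\<lambda>x. \<lambda>i\<in>I. \<lambda>j\<in>J. \<phi> (g i) x \<in> B j) \<le> \<H>(\<lambda>x. \<lambda>j\<in>J. \<lambda>i\<in>I. \<phi> (g i) x \<in> B j)"
    proof (rule entropy_factor_le)
      show "simple_function M (\<lambda>x. \<lambda>j\<in>J. \<lambda>i\<in>I. \<phi> (g i) x \<in> B j)"
        by (rule simple_function_tuple[OF J sf])
    qed (simp add: restrict_eq_iff)
    also have "\<dots> \<le> (\<Sum>j\<in>J. \<H>(\<lambda>x. \<lambda>i\<in>I. \<phi> (g i) x \<in> B j))"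
      by (rule entropy_tuple_le[OF J sf])
    also have "\<dots> \<le> (\<Sum>j\<in>J. c j + real (card I) * d)"
      by (intro sum_mono c I)
    also have "\<dots> = sum c J + real (card I) * (real (card J) * d)"
      by (simp add: sum.distrib)
    also have "real (card J) * d \<le> e"
      using e by (simp add: d_def field_simps)
    finally show "\<H>(\<lambda>x. \<lambda>i\<in>I. \<lambda>j\<in>J. \<phi> (g i) x \<in> B j) \<le> sum c J + real (card I) * e"
      by (simp add: mult_left_mono)
  qed
qed

text \<open>The pattern \<open>Y\<close> of the almost periodic sets grows at rate at most
  \<open>e\<close> along the orbit. Once the patterns at all times in \<open>I\<close> are known,
  each time leaves at most \<open>m\<close> values of \<open>X\<close> with positive probability,
  hence at most \<open>m ^ card I\<close> orbit tuples.\<close>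

lemma entropy_growth_le_log_card:
  assumes X: "simple_function M X" and J: "finite J" and B: "\<And>j. j \<in> J \<Longrightarrow> almost_periodic (B j)"
    and m: "m > 0" and card: "\<And>s. card {u \<in> range X. prob (X -` {u} \<inter> {x. (\<lambda>j\<in>J. x \<in> B j) = s}) > 0} \<le> m"
    and e: "e > 0"
  obtains c where "\<And>(I :: nat set) g. finite I \<Longrightarrow> g ` I \<subseteq> S \<Longrightarrow>
    \<H>(\<lambda>x. \<lambda>i\<in>I. X (\<phi> (g i) x)) \<le> c + real (card I) * (ln (real m) + e)"
proof -
  obtain c where c: "\<And>(I :: nat set) g. finite I \<Longrightarrow> g ` I \<subseteq> S \<Longrightarrow>
    \<H>(\<lambda>x. \<lambda>i\<in>I. \<lambda>j\<in>J. \<phi> (g i) x \<in> B j) \<le> c + real (card I) * e"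
    by (rule almost_periodic_entropy_growth[OF J B e]) blast+
  define Y where "Y x = (\<lambda>j\<in>J. x \<in> B j)" for x
  have Y: "simple_function M Y"
    unfolding Y_def by (intro simple_function_tuple J simple_function_event almost_periodic_event B)
  define W where "W s = {u \<in> range X. prob (X -` {u} \<inter> {x. Y x = s}) > 0}" for s
  have fW: "finite (W s)" "card (W s) \<le> m" for s
    using simple_functionD(1)[OF X] card[of s] by (simp_all add: W_def Y_def space_UNIV)
  show thesis
  proof (rule that)
    fix I :: "nat set" and g :: "nat \<Rightarrow> 'g" assume I: "finite I" "g ` I \<subseteq> S"
    define TX where "TX x = (\<lambda>i\<in>I. X (\<phi> (g i) x))" for x
    define TY where "TY x = (\<lambda>i\<in>I. Y (\<phi> (g i) x))" for x
    have TX: "simple_function M TX" unfolding TX_def by (rule simple_function_orbit[OF X I])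
    have TY: "simple_function M TY" unfolding TY_def by (rule simple_function_orbit[OF Y I])
    have "\<H>(TX) \<le> \<H>(TY) + log (exp 1) (real (m ^ card I))"
    proof (rule entropy_le_entropy_plus_log_card[OF TX TY])
      fix v
      \<comment> \<open>Invariance of the measure is used here: a tuple of positive probability
        projects at each time \<open>i\<close> to a value and a pattern that meet in positive
        probability at time zero.\<close>
      have "{u \<in> TX ` space M. prob (TX -` {u} \<inter> TY -` {v} \<inter> space M) > 0} \<subseteq> PiE I (\<lambda>i. W (v i))"
      proof safe
        fix x i assume pos: "prob (TX -` {TX x} \<inter> TY -` {v} \<inter> space M) > 0" and i: "i \<in> I"
        have gi: "g i \<in> S" using i I by auto
        let ?E = "X -` {TX x i} \<inter> {y. Y y = v i}"
        have E: "?E \<in> events"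
          using events_fibre[OF X Y, of "{TX x i}" "{v i}"] by (simp add: space_UNIV vimage_def)
        have "prob (TX -` {TX x} \<inter> TY -` {v} \<inter> space M) \<le> prob (\<phi> (g i) -` ?E)"
        proof (rule finite_measure_mono)
          show "TX -` {TX x} \<inter> TY -` {v} \<inter> space M \<subseteq> \<phi> (g i) -` ?E"
          proof
            fix y assume "y \<in> TX -` {TX x} \<inter> TY -` {v} \<inter> space M"
            then have "TX y i = TX x i" "TY y i = v i" by simp_all
            then show "y \<in> \<phi> (g i) -` ?E" using i by (simp add: TX_def TY_def)
          qed
        qed (rule vimage_event[OF gi E])
        then have "prob ?E > 0" using pos map_prob[OF gi E] by simp
        then show "TX x i \<in> W (v i)" using i by (auto simp: W_def TX_def)
      next
        fix x i assume "i \<notin> I"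
        then show "TX x i = undefined" by (simp add: TX_def)
      qed
      then have "card {u \<in> TX ` space M. prob (TX -` {u} \<inter> TY -` {v} \<inter> space M) > 0}
          \<le> card (PiE I (\<lambda>i. W (v i)))"
        by (intro card_mono finite_PiE I fW)
      also have "\<dots> = (\<Prod>i\<in>I. card (W (v i)))" by (rule card_PiE[OF I(1)])
      also have "\<dots> \<le> (\<Prod>i\<in>I. m)" by (intro prod_mono) (simp add: fW)
      finally show "card {u \<in> TX ` space M. prob (TX -` {u} \<inter> TY -` {v} \<inter> space M) > 0} \<le> m ^ card I"
        by simp
    qed (use m in simp)
    also have "\<H>(TY) \<le> c + real (card I) * e"
      using c[OF I] by (simp add: TY_def[abs_def] Y_def)
    also have "log (exp 1) (real (m ^ card I)) = real (card I) * ln (real m)"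
      using m by (simp add: log_def ln_realpow)
    finally have "\<H>(TX) \<le> c + real (card I) * (ln (real m) + e)"
      by (simp add: algebra_simps)
    then show "\<H>(\<lambda>x. \<lambda>i\<in>I. X (\<phi> (g i) x)) \<le> c + real (card I) * (ln (real m) + e)"
      unfolding TX_def[abs_def] .
  qed
qed

text \<open>The greedy choice. Unions of atoms of the partition generated so far are finitely many
  events, so they fail to be a net and some translate stays \<open>e\<close> away from all of them.
  By \<open>event_approximable_by_fibres\<close>, adding that translate raises the entropy by at
  least \<open>e\<close>.\<close>

lemma not_almost_periodic_entropy_growth:
  assumes X: "simple_function M X" and nap: "\<not> almost_periodic (X -` U)"
  obtains e g where "e > 0" "range g \<subseteq> S"
    "\<And>n. real n * e \<le> \<H>(\<lambda>x. \<lambda>i\<in>{1..n}. X (\<phi> (g i) x))"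
proof -
  have U: "X -` U \<in> events" using simple_functionD(2)[OF X] by (simp add: space_UNIV)
  then obtain e where e: "e > 0" and far: "\<And>F. finite F \<Longrightarrow> F \<subseteq> events \<Longrightarrow>
      \<exists>g\<in>S. \<forall>C\<in>F. prob (sym_diff (\<phi> g -` (X -` U)) C) \<ge> e"
    using nap unfolding almost_periodic_def not_less[symmetric] by metis
  define T where "T D x = (\<lambda>h\<in>D. X (\<phi> h x))" for D x
  have T: "simple_function M (T D)" if "finite D" "D \<subseteq> S" for D
    unfolding T_def using simple_function_orbit[OF X that(1), of id] that(2) by simp
  have "\<exists>g. g \<in> S \<and> \<H>(T D) + e \<le> \<H>(T (insert g D))" if D: "finite D" "D \<subseteq> S" for D
  proof -
    note TD = T[OF D]
    have "finite (range (T D))" using simple_functionD(1)[OF TD] by (simp add: space_UNIV)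
    moreover have "T D -` V \<in> events" for V
      using simple_functionD(2)[OF TD, of V] by (simp add: space_UNIV)
    ultimately have "\<exists>g\<in>S. \<forall>C\<in>(\<lambda>V. T D -` V) ` Pow (range (T D)).
        prob (sym_diff (\<phi> g -` (X -` U)) C) \<ge> e"
      by (intro far) auto
    then obtain g where g: "g \<in> S"
        "\<And>V. V \<subseteq> range (T D) \<Longrightarrow> prob (sym_diff (\<phi> g -` (X -` U)) (T D -` V)) \<ge> e"
      by auto
    have gU: "\<phi> g -` (X -` U) \<in> events" by (rule vimage_event[OF g(1) U])
    obtain V where V: "prob (sym_diff (\<phi> g -` (X -` U)) (T D -` V \<inter> space M))
        \<le> ln (exp 1) * conditional_entropy (exp 1) (count_space ((\<lambda>x. x \<in> \<phi> g -` (X -` U)) ` space M))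
            (count_space (T D ` space M)) (\<lambda>x. x \<in> \<phi> g -` (X -` U)) (T D)"
      by (rule event_approximable_by_fibres[OF gU TD])
    \<comment> \<open>Trimming \<open>V\<close> to the range brings its preimage into the finite
      family that \<open>g\<close> was chosen against.\<close>
    have "T D -` V \<inter> space M = T D -` (V \<inter> range (T D))" by (auto simp: space_UNIV)
    then have "e \<le> prob (sym_diff (\<phi> g -` (X -` U)) (T D -` V \<inter> space M))"
      using g(2)[of "V \<inter> range (T D)"] by simp
    with V have "\<H>(T D) + e \<le> \<H>(\<lambda>x. (T D x, x \<in> \<phi> g -` (X -` U)))"
      using entropy_chain_rule[OF TD simple_function_event[OF gU]] by simp
    also have "\<dots> \<le> \<H>(T (insert g D))"
    proof (rule entropy_factor_le[OF T])
      fix x y assume "T (insert g D) x = T (insert g D) y"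
      then have "X (\<phi> g x) = X (\<phi> g y)" "T D x = T D y" by (simp_all add: T_def restrict_eq_iff)
      then show "(T D x, x \<in> \<phi> g -` (X -` U)) = (T D y, y \<in> \<phi> g -` (X -` U))" by simp
    qed (use D g in auto)
    finally show ?thesis using g(1) by blast
  qed
  then obtain c where c: "\<And>D. finite D \<Longrightarrow> D \<subseteq> S \<Longrightarrow> c D \<in> S"
      "\<And>D. finite D \<Longrightarrow> D \<subseteq> S \<Longrightarrow> \<H>(T D) + e \<le> \<H>(T (insert (c D) D))"
    by metis
  define E where "E = rec_nat {} (\<lambda>_ D. insert (c D) D)"
  have E_simps: "E 0 = {}" "\<And>n. E (Suc n) = insert (c (E n)) (E n)" by (simp_all add: E_def)
  have E: "finite (E n) \<and> E n \<subseteq> S" for n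
    by (induction n) (auto simp: E_simps c)
  \<comment> \<open>The shift makes indices 1 to \<open>n\<close> enumerate \<open>E n\<close>, as
    joins run over \<open>{1..n}\<close>. Truncated subtraction gives index 0 the same value as
    index 1.\<close>
  define g where "g i = c (E (i - 1))" for i
  have gE: "g ` {1..n} = E n" for n
    by (induction n) (simp_all add: E_simps atLeastAtMostSuc_conv g_def)
  show thesis
  proof (rule that[OF e])
    show gS: "range g \<subseteq> S" using c(1) E by (auto simp: g_def)
    fix n
    have "real n * e \<le> \<H>(T (E n))"
    proof (induction n)
      case 0
      show ?case using entropy_nonneg[OF T] E[of 0] by simp
    next
      case (Suc n)
      have "real (Suc n) * e = real n * e + e" by (simp add: algebra_simps)
      also have "\<dots> \<le> \<H>(T (E n)) + e" using Suc by simp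
      also have "\<dots> \<le> \<H>(T (E (Suc n)))" using c(2) E unfolding E_simps by blast
      finally show ?case .
    qed
    \<comment> \<open>\<open>T (E n)\<close> is indexed by group elements and the orbit tuple by
      times; since \<open>g\<close> maps \<open>{1..n}\<close> onto \<open>E n\<close>, the latter
      determines the former.\<close>
    also have "\<dots> \<le> \<H>(\<lambda>x. \<lambda>i\<in>{1..n}. X (\<phi> (g i) x))"
    proof (rule entropy_factor_le)
      show "simple_function M (\<lambda>x. \<lambda>i\<in>{1..n}. X (\<phi> (g i) x))"
        using gS by (intro simple_function_orbit[OF X]) auto
      fix x y assume "(\<lambda>i\<in>{1..n}. X (\<phi> (g i) x)) = (\<lambda>i\<in>{1..n}. X (\<phi> (g i) y))"
      then show "T (E n) x = T (E n) y"
        unfolding gE[symmetric] T_def restrict_eq_iff by blast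
    qed
    finally show "real n * e \<le> \<H>(\<lambda>x. \<lambda>i\<in>{1..n}. X (\<phi> (g i) x))" .
  qed
qed

end

section \<open>Entropy of joins of partitions\<close>

text \<open>For a disjoint family this is the member containing \<open>x\<close>, with default
  \<open>{}\<close> off the union. It turns a partition into a simple function, the null remainder
  becoming one more fibre.\<close>

definition cell :: "'x set set \<Rightarrow> 'x \<Rightarrow> 'x set" where
  "cell \<alpha> x = \<Union>{A \<in> \<alpha>. x \<in> A}"

lemma cell_eq: "disjoint \<alpha> \<Longrightarrow> A \<in> \<alpha> \<Longrightarrow> x \<in> A \<Longrightarrow> cell \<alpha> x = A"
  unfolding cell_def disjoint_def by blast

lemma cell_outside: "x \<notin> \<Union>\<alpha> \<Longrightarrow> cell \<alpha> x = {}"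
  unfolding cell_def by blast

text \<open>Nonemptiness matters, as the fibre over \<open>{}\<close> is the complement of the
  union.\<close>

lemma vimage_cell:
  assumes "disjoint \<alpha>" "A \<in> \<alpha>" "A \<noteq> {}"
  shows "cell \<alpha> -` {A} = A"
proof (intro equalityI subsetI)
  fix x assume "x \<in> cell \<alpha> -` {A}"
  then have x: "cell \<alpha> x = A" by simp
  then obtain B where "B \<in> \<alpha>" "x \<in> B" using assms(3) unfolding cell_def by blast
  then show "x \<in> A" using cell_eq[OF assms(1), of B x] x by simp
qed (simp add: cell_eq assms)

lemma vimage_cell_empty:
  assumes "disjoint \<alpha>"
  shows "cell \<alpha> -` {{}} = - \<Union>\<alpha>"
  using cell_eq[OF assms] cell_outside[of _ \<alpha>] by fastforce

lemma cell_in: "disjoint \<alpha> \<Longrightarrow> cell \<alpha> x \<in> insert {} \<alpha>"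
  using cell_eq[of \<alpha>] cell_outside[of x \<alpha>] by blast

lemma cell_image_vimage: "cell ((\<lambda>A. f -` A) ` \<alpha>) x = f -` cell \<alpha> (f x)"
  unfolding cell_def by blast

lemma measurable_partitionsD:
  assumes "\<alpha> \<in> measurable_partitions \<mu>"
  shows "finite \<alpha>" "disjoint \<alpha>" "A \<in> \<alpha> \<Longrightarrow> A \<in> sets (completion \<mu>)"
    "\<Union>\<alpha> \<in> sets (completion \<mu>)"
    "emeasure (completion \<mu>) (\<Union>\<alpha>) = emeasure (completion \<mu>) (space \<mu>)"
  using assms unfolding measurable_partitions_def by (auto intro!: sets.finite_Union)

lemma simple_function_cell:
  assumes \<alpha>: "\<alpha> \<in> measurable_partitions \<mu>" and sp: "space \<mu> = UNIV"
  shows "simple_function (completion \<mu>) (cell \<alpha>)"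
  unfolding simple_function_def
proof (intro conjI ballI)
  note d = measurable_partitionsD[OF \<alpha>]
  show "finite (cell \<alpha> ` space (completion \<mu>))"
    by (rule finite_subset[of _ "insert {} \<alpha>"]) (rule image_subsetI cell_in[OF d(2)] | simp add: d(1))+
  fix A assume "A \<in> cell \<alpha> ` space (completion \<mu>)"
  then have A: "A \<in> insert {} \<alpha>" using cell_in[OF d(2)] by (elim imageE) simp
  show "cell \<alpha> -` {A} \<inter> space (completion \<mu>) \<in> sets (completion \<mu>)"
  proof (cases "A = {}")
    case True
    have "space (completion \<mu>) - \<Union>\<alpha> \<in> sets (completion \<mu>)" using d(4) by (rule sets.compl_sets)
    then show ?thesis using True vimage_cell_empty[OF d(2)] by (simp add: sp Compl_eq_Diff_UNIV)
  next
    case False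
    then have "A \<in> \<alpha>" using A by simp
    then show ?thesis using False vimage_cell[OF d(2)] d(3) by (simp add: sp)
  qed
qed

lemma prob_Compl_Union_partition:
  assumes "prob_space \<mu>" "space \<mu> = UNIV" "\<alpha> \<in> measurable_partitions \<mu>"
  shows "- \<Union>\<alpha> \<in> null_sets (completion \<mu>)"
proof -
  interpret N: prob_space "completion \<mu>" by (rule prob_space.prob_space_completion) fact
  note d = measurable_partitionsD[OF assms(3)]
  have "emeasure (completion \<mu>) (space (completion \<mu>) - \<Union>\<alpha>) = 0"
    using d(4,5) N.emeasure_space_1 by (subst emeasure_compl) (simp_all del: emeasure_completion)
  then show ?thesis
    using sets.compl_sets[OF d(4)] by (simp add: null_sets_def assms(2) Compl_eq_Diff_UNIV)
qed

text \<open>The join and the fibres of \<open>T\<close> differ in two ways: the join merges equal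
  intersections, and \<open>T\<close> may take the default \<open>{}\<close> in a coordinate. The
  first affects only the empty set and the second only null sets, so neither changes the sum of the
  terms \<open>\<eta>\<close>.\<close>

lemma partition_entropy_join:
  fixes P :: "'i \<Rightarrow> 'x set set"
  assumes \<mu>: "prob_space \<mu>" "space \<mu> = UNIV" and I: "finite I"
    and P: "\<And>i. i \<in> I \<Longrightarrow> P i \<in> measurable_partitions \<mu>"
  defines "T \<equiv> \<lambda>x. \<lambda>i\<in>I. cell (P i) x"
  shows "partition_entropy \<mu> (partition_join I P) =
    prob_space.entropy (completion \<mu>) (exp 1) (count_space (T ` space (completion \<mu>))) T"
proof -
  interpret N: prob_space "completion \<mu>" by (rule prob_space.prob_space_completion) fact
  interpret N: information_space "completion \<mu>" "exp 1" by unfold_locales simp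
  define \<eta> where "\<eta> A = measure (completion \<mu>) A * ln (measure (completion \<mu>) A)" for A
  have \<eta>0: "\<eta> {} = 0" by (simp add: \<eta>_def)
  note d = measurable_partitionsD[OF P]
  let ?J = "\<lambda>s. \<Inter>i\<in>I. s i"
  let ?Q = "PiE I (\<lambda>i. insert {} (P i))"
  have fin: "finite (PiE I P)" "finite ?Q" using I d(1) by (auto intro!: finite_PiE)
  have T: "simple_function (completion \<mu>) T"
    unfolding T_def by (intro N.simple_function_tuple I simple_function_cell P \<mu>)
  have TQ: "T x \<in> ?Q" for x
    unfolding T_def using cell_in[OF d(2)] by (auto simp: PiE_iff)
  \<comment> \<open>A coordinate equal to \<open>{}\<close> forces the point off the union of
    \<open>P i\<close>, into a null set.\<close>
  have zero: "\<eta> (T -` {s}) = 0" if s: "s \<in> ?Q" and i: "i \<in> I" "s i = {}" for s i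
  proof -
    have "T -` {s} \<subseteq> - \<Union>(P i)"
    proof
      fix x assume "x \<in> T -` {s}"
      then have "cell (P i) x = s i" using i unfolding T_def by auto
      then show "x \<in> - \<Union>(P i)" using vimage_cell_empty[OF d(2)[OF i(1)]] i by auto
    qed
    then have "T -` {s} \<in> null_sets (completion \<mu>)"
      by (rule null_sets_completion_subset[OF _ prob_Compl_Union_partition[OF \<mu> P[OF i(1)]]])
    then have "measure (completion \<mu>) (T -` {s}) = 0" by (simp add: null_sets_def measure_def)
    then show ?thesis by (simp add: \<eta>_def)
  qed
  have "partition_entropy \<mu> (partition_join I P) = - sum \<eta> (?J ` PiE I P)"
    by (simp add: partition_entropy_def partition_join_def \<eta>_def)
  also have "sum \<eta> (?J ` PiE I P) = (\<Sum>s\<in>PiE I P. \<eta> (?J s))"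
  proof (subst sum.reindex_nontrivial)
    \<comment> \<open>Two choices with the same intersection differ in some coordinate, where their
      sets are disjoint; the intersection is therefore empty.\<close>
    fix s t assume st: "s \<in> PiE I P" "t \<in> PiE I P" "s \<noteq> t" "?J s = ?J t"
    then obtain i where i: "i \<in> I" "s i \<noteq> t i" by (metis PiE_ext)
    then have "s i \<inter> t i = {}"
      using st d(2)[OF i(1)] by (auto simp: disjoint_def PiE_iff)
    then have "?J s = {}" using i(1) st(4) by blast
    then show "\<eta> (?J s) = 0" by (simp add: \<eta>0)
  qed (simp_all add: fin)
  also have "\<dots> = (\<Sum>s\<in>?Q. \<eta> (T -` {s}))"
  proof (rule sum.mono_neutral_cong_left)
    show "PiE I P \<subseteq> ?Q" by (intro PiE_mono) auto
    show "\<forall>s\<in>?Q - PiE I P. \<eta> (T -` {s}) = 0"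
    proof
      fix s assume s: "s \<in> ?Q - PiE I P"
      then obtain i where "i \<in> I" "s i \<notin> P i" by (auto simp: PiE_iff)
      then show "\<eta> (T -` {s}) = 0" using s zero[of s i] by (auto simp: PiE_iff)
    qed
    fix s assume s: "s \<in> PiE I P"
    show "\<eta> (?J s) = \<eta> (T -` {s})"
    proof (cases "\<exists>i\<in>I. s i = {}")
      case True
      \<comment> \<open>\<open>{}\<close> may itself belong to \<open>P i\<close>. Then the
        intersection is empty while the fibre may be a nonempty null set; both contribute 0.\<close>
      then obtain i where i: "i \<in> I" "s i = {}" by blast
      have "?J s = {}" using i by blast
      moreover have "s \<in> ?Q" using s by (auto simp: PiE_iff)
      ultimately show ?thesis using zero[of s i] i by (simp add: \<eta>0)
    next
      case False
      have "T -` {s} = ?J s"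
      proof (rule Set.set_eqI)
        fix x
        have "x \<in> T -` {s} \<longleftrightarrow> (\<forall>i\<in>I. cell (P i) x = s i)"
          using s by (auto simp: T_def fun_eq_iff PiE_iff extensional_def)
        also have "\<dots> \<longleftrightarrow> (\<forall>i\<in>I. x \<in> s i)"
        proof (intro ball_cong refl)
          fix i assume i: "i \<in> I"
          then have "cell (P i) -` {s i} = s i"
            using False s by (intro vimage_cell d) auto
          then show "cell (P i) x = s i \<longleftrightarrow> x \<in> s i" by blast
        qed
        finally show "x \<in> T -` {s} \<longleftrightarrow> x \<in> ?J s" by auto
      qed
      then show ?thesis by simp
    qed
  qed (rule fin)
  also have "\<dots> = (\<Sum>s\<in>range T. \<eta> (T -` {s}))"
  proof (intro sum.mono_neutral_right ballI)
    show "range T \<subseteq> ?Q" using TQ by auto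
    fix s assume "s \<in> ?Q - range T"
    then have "T -` {s} = {}" by auto
    then show "\<eta> (T -` {s}) = 0" by (simp add: \<eta>0)
  qed (rule fin)
  finally show ?thesis
    by (subst N.entropy_simple_function[OF T]) (simp add: \<mu>(2) \<eta>_def log_def)
qed

section \<open>Invariance on the completed \<sigma>-algebra\<close>

text \<open>A set of the completion is a set of \<open>\<mu>\<close> together with a part of a null
  set, and the preimage of a null set is null.\<close>

lemma completion_preserves:
  assumes \<mu>: "prob_space \<mu>" and f: "f \<in> \<mu> \<rightarrow>\<^sub>M \<mu>" and sp: "space \<mu> = UNIV"
    and pres: "\<And>A. A \<in> sets \<mu> \<Longrightarrow> emeasure \<mu> (f -` A) = emeasure \<mu> A"
    and A: "A \<in> sets (completion \<mu>)"
  shows "f -` A \<in> sets (completion \<mu>)" "measure (completion \<mu>) (f -` A) = measure (completion \<mu>) A"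
proof -
  obtain S N N' where SN: "A = S \<union> N" "N \<subseteq> N'" "N' \<in> null_sets \<mu>" "S \<in> sets \<mu>"
    using A by (rule sets_completionE)
  have S: "f -` S \<in> sets \<mu>" and N': "f -` N' \<in> sets \<mu>"
    using measurable_sets[OF f] SN by (auto simp: sp null_sets_def)
  then have N'0: "f -` N' \<in> null_sets \<mu>" using pres SN by (auto simp: null_sets_def)
  have N: "N \<in> null_sets (completion \<mu>)" "f -` N \<in> null_sets (completion \<mu>)"
    by (rule null_sets_completion_subset[OF _ null_sets_completionI[OF SN(3)]], fact)
      (rule null_sets_completion_subset[OF _ null_sets_completionI[OF N'0]], use SN(2) in auto)
  have vA: "f -` A = f -` S \<union> f -` N" using SN by auto
  show "f -` A \<in> sets (completion \<mu>)"
    unfolding vA using S N by (auto simp: null_sets_def)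
  have "emeasure (completion \<mu>) (f -` A) = emeasure \<mu> (f -` S)"
    unfolding vA using S N by (subst emeasure_Un_null_set) auto
  also have "\<dots> = emeasure (completion \<mu>) A"
    unfolding SN(1) pres[OF SN(4)] using SN(4) N by (subst emeasure_Un_null_set) auto
  finally show "measure (completion \<mu>) (f -` A) = measure (completion \<mu>) A"
    by (simp add: measure_def)
qed

lemma measure_preserving_maps_completion:
  assumes G: "action_by_homeomorphisms G \<phi>" and \<mu>: "\<mu> \<in> invariant_measures G \<phi>"
  shows "measure_preserving_maps (completion \<mu>) \<phi> (carrier G)"
proof -
  have P: "prob_space \<mu>" and sb: "sets \<mu> = sets borel"
    and inv: "\<And>g A. g \<in> carrier G \<Longrightarrow> A \<in> sets borel \<Longrightarrow> emeasure \<mu> (\<phi> g -` A) = emeasure \<mu> A"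
    using \<mu> by (auto simp: invariant_measures_def)
  have sp: "space \<mu> = UNIV" using sets_eq_imp_space_eq[OF sb] by simp
  interpret N: prob_space "completion \<mu>" by (rule prob_space.prob_space_completion) fact
  have f: "\<phi> g \<in> \<mu> \<rightarrow>\<^sub>M \<mu>" if "g \<in> carrier G" for g
  proof -
    have "homeomorphic_map euclidean euclidean (\<phi> g)"
      using G that by (auto simp: action_by_homeomorphisms_def)
    then have "continuous_on UNIV (\<phi> g)"
      by (simp add: homeomorphic_imp_continuous_map flip: continuous_map_iff_continuous2)
    then have "\<phi> g \<in> borel \<rightarrow>\<^sub>M borel" by (rule borel_measurable_continuous_onI)
    then show ?thesis using measurable_cong_sets[OF sb sb] by simp
  qed
  show ?thesis
  proof
    show "space (completion \<mu>) = UNIV" by (simp add: sp)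
    fix g assume g: "g \<in> carrier G"
    note pr = completion_preserves[OF P f[OF g] sp]
    show "\<phi> g \<in> completion \<mu> \<rightarrow>\<^sub>M completion \<mu>"
      using pr(1) inv[OF g] by (intro measurableI) (auto simp: sp sb)
    fix A assume "A \<in> N.events"
    then show "N.prob (\<phi> g -` A) = N.prob A" using pr(2) inv[OF g] by (simp add: sb)
  qed
qed

text \<open>The cells of a translated partition are preimages of cells of \<alpha>. Each map is
  surjective, so a preimage determines its cell; both tuples have the same fibres and hence the same
  entropy.\<close>

lemma partition_entropy_join_orbit:
  fixes \<phi> :: "'g \<Rightarrow> 'x::topological_space \<Rightarrow> 'x"
  assumes G: "action_by_homeomorphisms G \<phi>" and \<mu>: "\<mu> \<in> invariant_measures G \<phi>"
    and \<alpha>: "\<alpha> \<in> measurable_partitions \<mu>" and g: "g ` I \<subseteq> carrier G" and I: "finite I"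
  defines "T \<equiv> \<lambda>x. \<lambda>i\<in>I. cell \<alpha> (\<phi> (g i) x)"
  shows "partition_entropy \<mu> (partition_join I (\<lambda>i. (\<lambda>A. \<phi> (g i) -` A) ` \<alpha>)) =
    prob_space.entropy (completion \<mu>) (exp 1) (count_space (T ` space (completion \<mu>))) T"
proof -
  interpret N: measure_preserving_maps "completion \<mu>" \<phi> "carrier G"
    by (rule measure_preserving_maps_completion[OF G \<mu>])
  have P: "prob_space \<mu>" using \<mu> by (auto simp: invariant_measures_def)
  have sp: "space \<mu> = UNIV" using N.space_UNIV by simp
  note d = measurable_partitionsD[OF \<alpha>]
  define Q where "Q i = (\<lambda>A. \<phi> (g i) -` A) ` \<alpha>" for i
  have Q: "Q i \<in> measurable_partitions \<mu>" if "i \<in> I" for i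
  proof -
    have gi: "g i \<in> carrier G" using g that by auto
    have "\<Union>(Q i) = \<phi> (g i) -` \<Union>\<alpha>" by (auto simp: Q_def)
    then have "emeasure (completion \<mu>) (\<Union>(Q i)) = emeasure (completion \<mu>) (space \<mu>)"
      using N.map_prob[OF gi d(4)] d(5) by (simp add: N.emeasure_eq_measure)
    moreover have "disjoint (Q i)"
      using d(2) by (auto simp: Q_def disjoint_def)
    ultimately show ?thesis
      using d(1,3) N.vimage_event[OF gi] by (auto simp: measurable_partitions_def Q_def)
  qed
  define T' where "T' = (\<lambda>x. \<lambda>i\<in>I. cell (Q i) x)"
  have surj: "surj (\<phi> h)" if "h \<in> carrier G" for h
    using G that homeomorphic_imp_surjective_map[of euclidean euclidean "\<phi> h"]
    by (simp add: action_by_homeomorphisms_def)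
  have iff: "T' x = T' y \<longleftrightarrow> T x = T y" for x y
    unfolding T'_def T_def restrict_eq_iff Q_def cell_image_vimage
  proof (intro ball_cong refl)
    fix i assume "i \<in> I"
    then have "surj (\<phi> (g i))" using g surj by auto
    then show "\<phi> (g i) -` cell \<alpha> (\<phi> (g i) x) = \<phi> (g i) -` cell \<alpha> (\<phi> (g i) y) \<longleftrightarrow>
        cell \<alpha> (\<phi> (g i) x) = cell \<alpha> (\<phi> (g i) y)"
      by (metis surj_image_vimage_eq)
  qed
  have T: "simple_function (completion \<mu>) T"
    unfolding T_def by (rule N.simple_function_orbit[OF simple_function_cell[OF \<alpha> sp] I g])
  have T': "simple_function (completion \<mu>) T'"
    unfolding T'_def by (intro N.simple_function_tuple I simple_function_cell Q sp)
  have "partition_entropy \<mu> (partition_join I Q) =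
      prob_space.entropy (completion \<mu>) (exp 1) (count_space (T' ` space (completion \<mu>))) T'"
    unfolding T'_def by (rule partition_entropy_join[OF P sp I Q])
  also have "\<dots> = prob_space.entropy (completion \<mu>) (exp 1) (count_space (T ` space (completion \<mu>))) T"
    using N.entropy_factor_le[OF T, of T'] N.entropy_factor_le[OF T', of T] iff by (intro antisym) auto
  finally show ?thesis unfolding Q_def .
qed

section \<open>Tuples separated by almost periodic sets\<close>

context measure_preserving_maps
begin

text \<open>
  In terms of the \<open>\<sigma>\<close>-algebra of almost periodic sets, this says that the product over \<open>k\<close> of the
  conditional probabilities of \<open>A k\<close> vanishes almost everywhere.
\<close>

definition separated :: "nat \<Rightarrow> (nat \<Rightarrow> 'x set) \<Rightarrow> bool" where
  "separated K A \<longleftrightarrow> (\<exists>E. (\<forall>k\<in>{1..K}. almost_periodic (E k) \<and> (AE x in M. x \<notin> A k \<or> x \<notin> E k)) \<and>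
     (AE x in M. \<exists>k\<in>{1..K}. x \<in> E k))"

lemma separatedI:
  assumes "\<And>k. k \<in> {1..K} \<Longrightarrow> almost_periodic (E k)"
    and "\<And>k. k \<in> {1..K} \<Longrightarrow> AE x in M. x \<notin> A k \<or> x \<notin> E k"
    and "AE x in M. \<exists>k\<in>{1..K}. x \<in> E k"
  shows "separated K A"
  unfolding separated_def by (intro exI[of _ E] conjI ballI assms)

lemma separatedE:
  assumes "separated K A"
  obtains E where "\<And>k. k \<in> {1..K} \<Longrightarrow> almost_periodic (E k)"
    "\<And>k. k \<in> {1..K} \<Longrightarrow> AE x in M. x \<notin> A k \<or> x \<notin> E k"
    "AE x in M. \<exists>k\<in>{1..K}. x \<in> E k"
proof -
  obtain E where "(\<forall>k\<in>{1..K}. almost_periodic (E k) \<and> (AE x in M. x \<notin> A k \<or> x \<notin> E k)) \<and>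
     (AE x in M. \<exists>k\<in>{1..K}. x \<in> E k)"
    using assms unfolding separated_def ..
  then show thesis by (intro that[of E]) simp_all
qed

lemma separated_mono:
  assumes "separated K B" and "\<And>k. k \<in> {1..K} \<Longrightarrow> AE x in M. x \<in> A k \<longrightarrow> x \<in> B k"
  shows "separated K A"
proof -
  obtain E where E: "\<And>k. k \<in> {1..K} \<Longrightarrow> almost_periodic (E k)"
    "\<And>k. k \<in> {1..K} \<Longrightarrow> AE x in M. x \<notin> B k \<or> x \<notin> E k"
    "AE x in M. \<exists>k\<in>{1..K}. x \<in> E k"
    by (rule separatedE[OF assms(1)]) blast
  show ?thesis
  proof (rule separatedI[of K E])
    fix k assume k: "k \<in> {1..K}"
    from E(2)[OF k] assms(2)[OF k] show "AE x in M. x \<notin> A k \<or> x \<notin> E k"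
      by eventually_elim blast
  qed (use E in auto)
qed

lemma separated_empty:
  assumes "k \<in> {1..K}" "A k = {}"
  shows "separated K A"
  using assms
  by (intro separatedI[of K "(\<lambda>_. {})(k := UNIV)"])
    (auto simp: almost_periodic_empty almost_periodic_UNIV)

text \<open>In coordinate \<open>k\<close> the separating sets are intersected over
  \<open>P\<close>, in the others they are united. A point outside the intersection misses some
  \<open>E p k\<close> and is therefore covered by another coordinate of the same
  \<open>p\<close>.\<close>

lemma separated_UN_coordinate:
  assumes P: "countable P" and k: "k \<in> {1..K}"
    and sep: "\<And>p. p \<in> P \<Longrightarrow> separated K (A(k := D p))"
  shows "separated K (A(k := \<Union>p\<in>P. D p))"
proof -
  have "\<exists>E. \<forall>p\<in>P. (\<forall>j\<in>{1..K}. almost_periodic (E p j) \<and> (AE x in M. x \<notin> (A(k := D p)) j \<or> x \<notin> E p j)) \<and>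
     (AE x in M. \<exists>j\<in>{1..K}. x \<in> E p j)"
    using sep unfolding separated_def by (intro bchoice) blast
  then obtain E where E: "\<And>p j. p \<in> P \<Longrightarrow> j \<in> {1..K} \<Longrightarrow> almost_periodic (E p j)"
    "\<And>p j. p \<in> P \<Longrightarrow> j \<in> {1..K} \<Longrightarrow> AE x in M. x \<notin> (A(k := D p)) j \<or> x \<notin> E p j"
    "\<And>p. p \<in> P \<Longrightarrow> AE x in M. \<exists>j\<in>{1..K}. x \<in> E p j"
    by blast
  define F where "F j = (if j = k then \<Inter>p\<in>P. E p j else \<Union>p\<in>P. E p j)" for j
  show ?thesis
  proof (rule separatedI[of K F])
    fix j assume j: "j \<in> {1..K}"
    show "almost_periodic (F j)"
      unfolding F_def using E(1) j P
      by (auto intro: almost_periodic_countable_INT almost_periodic_countable_UN)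
    have "AE x in M. \<forall>p\<in>P. x \<notin> (A(k := D p)) j \<or> x \<notin> E p j"
      using E(2) j P by (simp add: AE_ball_countable)
    then show "AE x in M. x \<notin> (A(k := \<Union>p\<in>P. D p)) j \<or> x \<notin> F j"
      by eventually_elim (auto simp: F_def)
  next
    have "AE x in M. \<forall>p\<in>P. \<exists>j\<in>{1..K}. x \<in> E p j"
      using E(3) P by (simp add: AE_ball_countable)
    then show "AE x in M. \<exists>j\<in>{1..K}. x \<in> F j"
    proof eventually_elim
      fix x assume x: "\<forall>p\<in>P. \<exists>j\<in>{1..K}. x \<in> E p j"
      show "\<exists>j\<in>{1..K}. x \<in> F j"
      proof (cases "\<forall>p\<in>P. x \<in> E p k")
        case True
        then have "x \<in> F k" by (simp add: F_def)
        then show ?thesis using k by blast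
      next
        case False
        then obtain p where p: "p \<in> P" "x \<notin> E p k" by blast
        then obtain j where j: "j \<in> {1..K}" "x \<in> E p j" using x by blast
        then have "j \<noteq> k" using p by auto
        then have "x \<in> F j" using p j by (auto simp: F_def)
        then show ?thesis using j by blast
      qed
    qed
  qed
qed

text \<open>The coordinates are replaced one at a time, \<open>m\<close> counting those already
  replaced. Keeping \<open>f\<close> arbitrary in the induction lets the next piece vary over
  \<open>P\<close>.\<close>

lemma separated_UN:
  assumes K: "K \<ge> 1" and P: "countable P" and sep: "\<And>f. (\<And>k. f k \<in> P) \<Longrightarrow> separated K (\<lambda>k. D k (f k))"
  shows "separated K (\<lambda>k. \<Union>p\<in>P. D k p)"
proof (cases "P = {}")
  case True
  then show ?thesis using K by (intro separated_empty[of 1]) auto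
next
  case False
  have step: "separated K (\<lambda>k. if k \<le> m then \<Union>p\<in>P. D k p else D k (f k))"
    if "m \<le> K" "\<And>k. f k \<in> P" for m f
    using that
  proof (induction m arbitrary: f)
    case 0
    \<comment> \<open>At this stage the two families differ at most at index 0, outside
      \<open>{1..K}\<close>.\<close>
    show ?case by (rule separated_mono[OF sep[of f]]) (use 0 in auto)
  next
    case (Suc m)
    let ?B = "\<lambda>k. if k \<le> m then \<Union>p\<in>P. D k p else D k (f k)"
    have "separated K (?B(Suc m := \<Union>p\<in>P. D (Suc m) p))"
    proof (rule separated_UN_coordinate[OF P])
      fix p assume p: "p \<in> P"
      have "separated K (\<lambda>k. if k \<le> m then \<Union>p\<in>P. D k p else D k ((f(Suc m := p)) k))"
        using Suc.prems p by (intro Suc.IH) auto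
      moreover have "(\<lambda>k. if k \<le> m then \<Union>p\<in>P. D k p else D k ((f(Suc m := p)) k)) = ?B(Suc m := D (Suc m) p)"
        by (simp add: fun_eq_iff)
      ultimately show "separated K (?B(Suc m := D (Suc m) p))" by simp
    qed (use Suc.prems in auto)
    moreover have "?B(Suc m := \<Union>p\<in>P. D (Suc m) p) = (\<lambda>k. if k \<le> Suc m then \<Union>p\<in>P. D k p else D k (f k))"
      by (simp add: fun_eq_iff le_Suc_eq)
    ultimately show ?case by simp
  qed
  obtain p where "p \<in> P" using False by blast
  then show ?thesis
    by (intro separated_mono[OF step[of K "\<lambda>_. p"]]) auto
qed

text \<open>The family collects the separating sets of all \<open>K\<close>-tuples of distinct
  values. If \<open>K\<close> values had positive probability on one atom, some separating set
  \<open>E u k\<close> would meet the atom and so contain it, although it meets the fibre over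
  \<open>u k\<close> only in a null set.\<close>

lemma separated_fibres_pattern:
  fixes X :: "'x \<Rightarrow> 'v"
  assumes X: "simple_function M X" and K: "K \<ge> 1"
    and sep: "\<And>u. u ` {1..K} \<subseteq> range X \<Longrightarrow> inj_on u {1..K} \<Longrightarrow> separated K (\<lambda>k. X -` {u k})"
  obtains J :: "((nat \<Rightarrow> 'v) \<times> nat) set" and B where "finite J" "\<And>j. j \<in> J \<Longrightarrow> almost_periodic (B j)"
    "\<And>s. card {u \<in> range X. prob (X -` {u} \<inter> {x. (\<lambda>j\<in>J. x \<in> B j) = s}) > 0} \<le> K - 1"
proof -
  have fX: "finite (range X)" using simple_functionD(1)[OF X] by (simp add: space_UNIV)
  define U where "U = {u \<in> PiE {1..K} (\<lambda>_. range X). inj_on u {1..K}}"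
  have fU: "finite U" unfolding U_def using fX by (auto intro!: finite_PiE)
  have "\<exists>E. \<forall>u\<in>U. (\<forall>k\<in>{1..K}. almost_periodic (E u k) \<and> (AE x in M. x \<notin> X -` {u k} \<or> x \<notin> E u k)) \<and>
     (AE x in M. \<exists>k\<in>{1..K}. x \<in> E u k)"
  proof (intro bchoice ballI)
    fix u assume "u \<in> U"
    then have "separated K (\<lambda>k. X -` {u k})" by (intro sep) (auto simp: U_def PiE_iff)
    then show "\<exists>E. (\<forall>k\<in>{1..K}. almost_periodic (E k) \<and> (AE x in M. x \<notin> X -` {u k} \<or> x \<notin> E k)) \<and>
     (AE x in M. \<exists>k\<in>{1..K}. x \<in> E k)" by (simp only: separated_def)
  qed
  then obtain E where E: "\<And>u k. u \<in> U \<Longrightarrow> k \<in> {1..K} \<Longrightarrow> almost_periodic (E u k)"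
    "\<And>u k. u \<in> U \<Longrightarrow> k \<in> {1..K} \<Longrightarrow> AE x in M. x \<notin> X -` {u k} \<or> x \<notin> E u k"
    "\<And>u. u \<in> U \<Longrightarrow> AE x in M. \<exists>k\<in>{1..K}. x \<in> E u k"
    by blast
  \<comment> \<open>An event of positive probability contains a point at which a given almost sure
    property holds; this turns the argument about measures into one about points.\<close>
  have ex: "\<exists>x\<in>A. P x" if pos: "prob A > 0" and P: "AE x in M. P x" for A P
  proof (rule ccontr)
    assume "\<not> (\<exists>x\<in>A. P x)"
    with P have "AE x in M. x \<notin> A" by (auto elim: eventually_mono)
    moreover have "A \<in> events" using pos measure_notin_sets[of A M] by force
    ultimately have "prob A = 0" by (simp add: AE_iff_measurable[of A M "\<lambda>x. x \<notin> A"] space_UNIV measure_def)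
    then show False using pos by simp
  qed
  define J where "J = U \<times> {1..K}"
  define B where "B = (\<lambda>(u, k). E u k)"
  show thesis
  proof (rule that[of J B])
    show "finite J" unfolding J_def using fU by simp
    show "almost_periodic (B j)" if "j \<in> J" for j
      using that E(1) by (auto simp: J_def B_def)
    fix s
    define W where "W = {u \<in> range X. prob (X -` {u} \<inter> {x. (\<lambda>j\<in>J. x \<in> B j) = s}) > 0}"
    have "card W \<le> K - 1"
    proof (rule ccontr)
      assume "\<not> card W \<le> K - 1"
      then have "K \<le> card W" using K by simp
      then obtain W' where W': "W' \<subseteq> W" "card W' = K" "finite W'"
        by (rule obtain_subset_with_card_n)
      obtain v where v: "bij_betw v {1..K} W'"
        using finite_same_card_bij[of "{1..K}" W'] W' by auto
      define u where "u = restrict v {1..K}"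
      have "u ` {1..K} = v ` {1..K}" by (intro image_cong) (simp_all add: u_def)
      then have u: "u ` {1..K} \<subseteq> W"
        using bij_betw_imp_surj_on[OF v] W'(1) by simp
      have "inj_on u {1..K} \<longleftrightarrow> inj_on v {1..K}" by (rule inj_on_cong) (simp add: u_def)
      then have inj: "inj_on u {1..K}" using bij_betw_imp_inj_on[OF v] by simp
      have "u k \<in> range X" if "k \<in> {1..K}" for k
        using u that unfolding W_def by blast
      then have "u \<in> PiE {1..K} (\<lambda>_. range X)" by (intro PiE_I) (auto simp: u_def)
      then have uU: "u \<in> U" using inj by (simp add: U_def)
      have pos: "prob (X -` {u k} \<inter> {x. (\<lambda>j\<in>J. x \<in> B j) = s}) > 0" if "k \<in> {1..K}" for k
        using u that unfolding W_def by blast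
      \<comment> \<open>The points \<open>x\<close> and \<open>y\<close> lie in the same atom, but
        \<open>x\<close> is in \<open>E u k\<close> and \<open>y\<close> is not.\<close>
      obtain x k where x: "(\<lambda>j\<in>J. x \<in> B j) = s" "k \<in> {1..K}" "x \<in> E u k"
        using ex[OF pos[of 1] E(3)[OF uU]] K by auto
      obtain y where y: "X y = u k" "(\<lambda>j\<in>J. y \<in> B j) = s" "y \<notin> E u k"
        using ex[OF pos[OF x(2)] E(2)[OF uU x(2)]] by auto
      have "(u, k) \<in> J" using uU x(2) by (simp add: J_def)
      moreover have "(\<lambda>j\<in>J. x \<in> B j) = (\<lambda>j\<in>J. y \<in> B j)" using x(1) y(2) by simp
      ultimately have "x \<in> B (u, k) \<longleftrightarrow> y \<in> B (u, k)" unfolding restrict_eq_iff by blast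
      then show False using x(3) y(3) by (simp add: B_def)
    qed
    then show "card {u \<in> range X. prob (X -` {u} \<inter> {x. (\<lambda>j\<in>J. x \<in> B j) = s}) > 0} \<le> K - 1"
      by (simp only: W_def)
  qed
qed

end

section \<open>Regularity and compactness\<close>

text \<open>Induction over the \<sigma>-algebra generated by the open sets. An open set is exhausted
  by the closed sets of points at distance at least \<open>1 / (n + 1)\<close> from its complement,
  and complementation swaps the inner and outer approximations.\<close>

lemma finite_borel_measure_regular:
  fixes M :: "'a::metric_space measure"
  assumes "finite_measure M" and sb: "sets M = sets borel" and B: "B \<in> sets borel" and e: "e > 0"
  shows "\<exists>C U. closed C \<and> open U \<and> C \<subseteq> B \<and> B \<subseteq> U \<and> measure M (U - C) < e"
proof -
  interpret finite_measure M by fact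
  have cm[simp]: "C \<in> sets M" if "closed C" for C using that by (simp add: sb)
  have om[simp]: "U \<in> sets M" if "open U" for U using that by (simp add: sb)
  have "B \<in> sigma_sets UNIV {S. open S}" using B by (simp add: borel_def)
  then show ?thesis using e
  proof (induction arbitrary: e)
    case (Basic A)
    then have A: "open A" by simp
    show ?case
    \<comment> \<open>\<open>infdist\<close> to the empty set is 0 by convention, so the whole space
      is treated apart.\<close>
    proof (cases "A = UNIV")
      case True
      then show ?thesis using Basic.prems by (intro exI[of _ UNIV]) simp
    next
      case False
      define C where "C n = {x. 1 / real (Suc n) \<le> infdist x (- A)}" for n
      have C: "closed (C n)" for n
        unfolding C_def by (intro closed_Collect_le continuous_intros)
      have "(\<lambda>n. measure M (C n)) \<longlonglongrightarrow> measure M (\<Union>n. C n)"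
      proof (rule finite_Lim_measure_incseq)
        show "incseq C"
        proof (rule incseq_SucI, rule subsetI)
          fix n x assume "x \<in> C n"
          moreover have "1 / real (Suc (Suc n)) \<le> 1 / real (Suc n)" by (simp add: frac_le)
          ultimately show "x \<in> C (Suc n)" unfolding C_def by (auto intro: order_trans)
        qed
      qed (use C in auto)
      also have "(\<Union>n. C n) = A"
      proof (intro equalityI subsetI)
        fix x assume "x \<in> (\<Union>n. C n)"
        then obtain n where "1 / real (Suc n) \<le> infdist x (- A)" by (auto simp: C_def)
        moreover have "0 < 1 / real (Suc n)" by simp
        ultimately have "infdist x (- A) \<noteq> 0" by linarith
        then show "x \<in> A" using infdist_zero[of x "- A"] by blast
      next
        fix x assume "x \<in> A"
        then have "infdist x (- A) \<noteq> 0"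
          using in_closed_iff_infdist_zero[of "- A" x] A False by auto
        then have "infdist x (- A) > 0" using infdist_nonneg[of x "- A"] by linarith
        then obtain n where "1 / real (Suc n) < infdist x (- A)"
          using nat_approx_posE by blast
        then show "x \<in> (\<Union>n. C n)" by (auto simp: C_def intro: less_imp_le)
      qed
      finally have "\<forall>\<^sub>F n in sequentially. measure M A - e < measure M (C n)"
        using Basic.prems by (intro order_tendstoD(1)) auto
      then obtain n where n: "measure M A - e < measure M (C n)"
        unfolding eventually_sequentially by blast
      have "C n \<subseteq> A" using \<open>(\<Union>n. C n) = A\<close> by blast
      then have "measure M (A - C n) < e"
        using n A C by (subst finite_measure_Diff) auto
      then show ?thesis using A C \<open>C n \<subseteq> A\<close> by blast
    qed
  next
    case Empty
    then show ?case by (intro exI[of _ "{}"]) simp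
  next
    case (Compl A)
    then obtain C U where CU: "closed C" "open U" "C \<subseteq> A" "A \<subseteq> U" "measure M (U - C) < e"
      using Compl.IH[OF Compl.prems] by metis
    have "(- C) - (- U) = U - C" by auto
    then have "closed (- U) \<and> open (- C) \<and> - U \<subseteq> - A \<and> - A \<subseteq> - C \<and> measure M ((- C) - (- U)) < e"
      using CU by auto
    then show ?case unfolding Compl_eq_Diff_UNIV by blast
  next
    case (Union A)
    \<comment> \<open>These tolerances sum to \<open>e / 2\<close>. The other half pays for
      replacing the union of the closed sets by a finite one, which is closed.\<close>
    define d where "d n = e / 4 * (1 / 2) ^ n" for n
    have "d n > 0" for n using Union.prems by (simp add: d_def)
    then have "\<forall>n. \<exists>C U. closed C \<and> open U \<and> C \<subseteq> A n \<and> A n \<subseteq> U \<and> measure M (U - C) < d n"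
      using Union.IH by blast
    then obtain C U where CU: "\<And>n. closed (C n)" "\<And>n. open (U n)" "\<And>n. C n \<subseteq> A n"
        "\<And>n. A n \<subseteq> U n" "\<And>n. measure M (U n - C n) < d n"
      by metis
    define V where "V n = (\<Union>i<n. C i)" for n
    have V: "closed (V n)" for n unfolding V_def using CU(1) by (intro closed_UN) auto
    have UC: "(\<Union>n. U n) \<in> sets M" "(\<Union>n. C n) \<in> sets M"
      using CU(1,2) by (auto intro!: sets.countable_UN)
    have dsum: "d sums (e / 2)"
      using sums_mult[OF geometric_sums[of "1 / 2 :: real"], of "e / 4"] by (simp add: d_def[abs_def])
    have "measure M (\<Union>n. U n - C n) \<le> e / 2"
    proof -
      have sm: "summable (\<lambda>n. measure M (U n - C n))"
        by (rule summable_comparison_test'[OF sums_summable[OF dsum]]) (use CU(5) in \<open>auto intro: less_imp_le\<close>)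
      have "measure M (\<Union>n. U n - C n) \<le> (\<Sum>n. measure M (U n - C n))"
        using CU(1,2) by (intro finite_measure_subadditive_countably sm) auto
      also have "\<dots> \<le> (\<Sum>n. d n)"
        by (intro suminf_le sm sums_summable[OF dsum] less_imp_le CU(5))
      finally show ?thesis using sums_unique[OF dsum] by simp
    qed
    moreover have "(\<lambda>n. measure M (V n)) \<longlonglongrightarrow> measure M (\<Union>n. V n)"
    proof (rule finite_Lim_measure_incseq)
      show "incseq V" unfolding V_def incseq_def by (meson UN_mono lessThan_subset_iff order_refl)
    qed (use V in auto)
    moreover have "(\<Union>n. V n) = (\<Union>n. C n)" unfolding V_def by auto
    ultimately have "\<forall>\<^sub>F n in sequentially. measure M (\<Union>n. C n) - e / 2 < measure M (V n)"
      using Union.prems by (intro order_tendstoD(1)) auto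
    then obtain n where n: "measure M (\<Union>n. C n) - e / 2 < measure M (V n)"
      unfolding eventually_sequentially by blast
    have "V n \<subseteq> (\<Union>n. C n)" unfolding V_def by auto
    then have "measure M ((\<Union>n. C n) - V n) < e / 2"
      using n V UC by (subst finite_measure_Diff) auto
    moreover have "measure M ((\<Union>n. U n) - V n) \<le> measure M ((\<Union>n. U n - C n) \<union> ((\<Union>n. C n) - V n))"
      using UC V CU by (intro finite_measure_mono) (auto intro!: sets.countable_UN sets.Un)
    moreover have "\<dots> \<le> measure M (\<Union>n. U n - C n) + measure M ((\<Union>n. C n) - V n)"
      using UC V CU by (intro measure_subadditive) (auto intro!: sets.countable_UN)
    ultimately have "measure M ((\<Union>n. U n) - V n) < e"
      using \<open>measure M (\<Union>n. U n - C n) \<le> e / 2\<close> by linarith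
    moreover have "V n \<subseteq> (\<Union>n. A n)" "(\<Union>n. A n) \<subseteq> (\<Union>n. U n)"
      using CU(3,4) unfolding V_def by blast+
    moreover have "open (\<Union>n. U n)" using CU(2) by auto
    ultimately show ?case using V by (intro exI[of _ "V n"] exI[of _ "\<Union>n. U n"] conjI)
  qed
qed

lemma completion_closed_exhaustion:
  fixes \<mu> :: "'a::metric_space measure"
  assumes \<mu>: "prob_space \<mu>" and sb: "sets \<mu> = sets borel" and A: "A \<in> sets (completion \<mu>)"
  shows "\<exists>C. (\<forall>n::nat. closed (C n) \<and> C n \<subseteq> A) \<and> (AE x in completion \<mu>. x \<in> A \<longrightarrow> x \<in> (\<Union>n. C n))"
proof -
  interpret prob_space \<mu> by fact
  obtain S N N' where SN: "A = S \<union> N" "N \<subseteq> N'" "N' \<in> null_sets \<mu>" "S \<in> sets \<mu>"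
    using A by (rule sets_completionE)
  have "\<exists>C U. closed C \<and> open U \<and> C \<subseteq> S \<and> S \<subseteq> U \<and> measure \<mu> (U - C) < 1 / real (Suc n)" for n
    using SN(4) by (intro finite_borel_measure_regular finite_measure_axioms sb) (auto simp: sb)
  then obtain C U where CU: "\<And>n. closed (C n)" "\<And>n. open (U n)" "\<And>n. C n \<subseteq> S"
      "\<And>n. S \<subseteq> U n" "\<And>n. measure \<mu> (U n - C n) < 1 / real (Suc n)"
    by metis
  have C: "C n \<in> sets \<mu>" "U n \<in> sets \<mu>" for n using CU by (auto simp: sb)
  have R: "S - (\<Union>n. C n) \<in> sets \<mu>" using SN(4) C by auto
  have "measure \<mu> (S - (\<Union>n. C n)) \<le> 0"
  proof (rule field_le_epsilon)
    fix e :: real assume "e > 0"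
    then obtain n where n: "1 / real (Suc n) < e" by (rule nat_approx_posE)
    have "measure \<mu> (S - (\<Union>n. C n)) \<le> measure \<mu> (U n - C n)"
      using CU(4) C by (intro finite_measure_mono) auto
    then show "measure \<mu> (S - (\<Union>n. C n)) \<le> 0 + e" using CU(5)[of n] n by simp
  qed
  then have "S - (\<Union>n. C n) \<in> null_sets \<mu>"
    using R by (simp add: null_sets_def emeasure_eq_measure measure_le_0_iff)
  then have "AE x in \<mu>. x \<in> A \<longrightarrow> x \<in> (\<Union>n. C n)"
    using AE_not_in[OF SN(3)] AE_not_in[of "S - (\<Union>n. C n)" \<mu>] SN(1,2)
    by (auto elim: eventually_elim2)
  then have "AE x in completion \<mu>. x \<in> A \<longrightarrow> x \<in> (\<Union>n. C n)" by (rule AE_completion)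
  then show ?thesis using CU(1,3) SN(1) by blast
qed

section \<open>From neighbourhoods to closed and then to measurable sets\<close>

text \<open>The product of the \<open>C k\<close> is compact and consists of injective tuples, so
  finitely many separated boxes cover it. Each \<open>C k\<close> is cut so finely that a product of
  nonempty pieces lies in a single box, and \<open>separated_UN\<close> reassembles the
  pieces.\<close>

lemma separated_disjoint_closed:
  fixes M :: "'x::metric_space measure"
  assumes M: "measure_preserving_maps M \<phi> S" and cpt: "compact (UNIV :: 'x set)" and K: "K \<ge> 1"
    and nbhd: "\<And>x. inj_on x {1..K} \<Longrightarrow>
      \<exists>U. (\<forall>k\<in>{1..K}. open (U k) \<and> x k \<in> U k) \<and> measure_preserving_maps.separated M \<phi> S K U"
    and C: "\<And>k. k \<in> {1..K} \<Longrightarrow> closed (C k)" and disj: "disjoint_family_on C {1..K}"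
  shows "measure_preserving_maps.separated M \<phi> S K C"
proof -
  interpret measure_preserving_maps M \<phi> S by fact
  let ?T = "product_topology (\<lambda>_. euclidean :: 'x topology) {1..K}"
  let ?X = "PiE {1..K} C"
  have inj: "inj_on x {1..K}" if "x \<in> ?X" for x
  proof (rule inj_onI, rule ccontr)
    fix i j assume ij: "i \<in> {1..K}" "j \<in> {1..K}" "x i = x j" "i \<noteq> j"
    then have "C i \<inter> C j = {}" using disj unfolding disjoint_family_on_def by blast
    moreover have "x i \<in> C i" "x j \<in> C j"
      using PiE_mem[OF that ij(1)] PiE_mem[OF that ij(2)] by simp_all
    ultimately show False using ij by auto
  qed
  have "\<exists>U. \<forall>x\<in>?X. (\<forall>k\<in>{1..K}. open (U x k) \<and> x k \<in> U x k) \<and> separated K (U x)"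
    by (intro bchoice ballI nbhd inj)
  then obtain U where U: "\<And>x k. x \<in> ?X \<Longrightarrow> k \<in> {1..K} \<Longrightarrow> open (U x k)"
      "\<And>x k. x \<in> ?X \<Longrightarrow> k \<in> {1..K} \<Longrightarrow> x k \<in> U x k" "\<And>x. x \<in> ?X \<Longrightarrow> separated K (U x)"
    by blast
  have "compact (C k)" if "k \<in> {1..K}" for k
    using compact_Int_closed[OF cpt C[OF that]] by simp
  then have "compactin ?T ?X" unfolding compactin_PiE by (simp add: compactin_euclidean_iff)
  moreover have "openin ?T (PiE {1..K} (U x))" if "x \<in> ?X" for x
    using U(1)[OF that] by (simp add: openin_PiE)
  moreover have "?X \<subseteq> \<Union>((\<lambda>x. PiE {1..K} (U x)) ` ?X)"
  proof
    fix x assume x: "x \<in> ?X"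
    then have "x \<in> PiE {1..K} (U x)" using U(2) by (auto simp: PiE_iff)
    then show "x \<in> \<Union>((\<lambda>x. PiE {1..K} (U x)) ` ?X)" using x by blast
  qed
  ultimately have "\<exists>F. finite F \<and> F \<subseteq> (\<lambda>x. PiE {1..K} (U x)) ` ?X \<and> ?X \<subseteq> \<Union>F"
    unfolding compactin_def by (metis (mono_tags, lifting) imageE)
  then obtain F where F: "finite F" "F \<subseteq> (\<lambda>x. PiE {1..K} (U x)) ` ?X" "?X \<subseteq> \<Union>F"
    by (elim exE conjE)
  obtain Y where "Y \<subseteq> ?X" "finite Y" "F = (\<lambda>x. PiE {1..K} (U x)) ` Y"
    using finite_subset_image[OF F(1,2)] by (elim exE conjE)
  then have Y: "finite Y" "Y \<subseteq> ?X" "?X \<subseteq> (\<Union>x\<in>Y. PiE {1..K} (U x))"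
    using F(3) by simp_all
  \<comment> \<open>The pattern of a point records which factors of the chosen boxes contain it;
    there are finitely many patterns.\<close>
  define pat where "pat y = {(x, k). x \<in> Y \<and> k \<in> {1..K} \<and> y \<in> U x k}" for y
  define P where "P = Pow (Y \<times> {1..K})"
  have P: "finite P" "\<And>y. pat y \<in> P" using Y(1) by (auto simp: P_def pat_def)
  define D where "D k p = {y \<in> C k. pat y = p}" for k p
  have "separated K (\<lambda>k. \<Union>p\<in>P. D k p)"
  proof (rule separated_UN[OF K countable_finite[OF P(1)]])
    fix f :: "nat \<Rightarrow> ((nat \<Rightarrow> 'x) \<times> nat) set"
    show "separated K (\<lambda>k. D k (f k))"
    proof (cases "\<exists>k\<in>{1..K}. D k (f k) = {}")
      case True
      then show ?thesis using separated_empty[of _ K "\<lambda>k. D k (f k)"] by blast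
    next
      case False
      then have "\<forall>k\<in>{1..K}. \<exists>y. y \<in> D k (f k)" by blast
      then obtain y where y: "\<And>k. k \<in> {1..K} \<Longrightarrow> y k \<in> D k (f k)" by metis
      have "restrict y {1..K} \<in> ?X" using y by (auto simp: D_def)
      then obtain x where x: "x \<in> Y" "restrict y {1..K} \<in> PiE {1..K} (U x)" using Y(3) by blast
      show ?thesis
      proof (rule separated_mono[OF U(3)])
        show "x \<in> ?X" using x(1) Y(2) by blast
        fix k assume k: "k \<in> {1..K}"
        have "y k \<in> U x k" using PiE_mem[OF x(2) k] k by simp
        \<comment> \<open>Points of one piece share their pattern, so the representative
          \<open>y k\<close> decides that the whole piece lies in \<open>U x k\<close>.\<close>
        then have "(x, k) \<in> f k" using y[OF k] x(1) k by (auto simp: D_def pat_def)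
        then have "D k (f k) \<subseteq> U x k" by (auto simp: D_def pat_def)
        then show "AE z in M. z \<in> D k (f k) \<longrightarrow> z \<in> U x k" by auto
      qed
    qed
  qed
  moreover have "(\<lambda>k. \<Union>p\<in>P. D k p) = C" using P(2) by (auto simp: D_def fun_eq_iff)
  ultimately show ?thesis by simp
qed

text \<open>Each \<open>A k\<close> is a countable union of closed subsets up to a null set. Any
  choice of one closed subset per coordinate is disjoint again.\<close>

lemma separated_disjoint:
  fixes \<mu> :: "'x::metric_space measure"
  assumes M: "measure_preserving_maps (completion \<mu>) \<phi> S" and \<mu>: "prob_space \<mu>" "sets \<mu> = sets borel"
    and cpt: "compact (UNIV :: 'x set)" and K: "K \<ge> 1"
    and nbhd: "\<And>x. inj_on x {1..K} \<Longrightarrow> \<exists>U. (\<forall>k\<in>{1..K}. open (U k) \<and> x k \<in> U k) \<and>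
      measure_preserving_maps.separated (completion \<mu>) \<phi> S K U"
    and A: "\<And>k. k \<in> {1..K} \<Longrightarrow> A k \<in> sets (completion \<mu>)" and disj: "disjoint_family_on A {1..K}"
  shows "measure_preserving_maps.separated (completion \<mu>) \<phi> S K A"
proof -
  interpret measure_preserving_maps "completion \<mu>" \<phi> S by fact
  have "\<exists>C. \<forall>k\<in>{1..K}. (\<forall>n::nat. closed (C k n) \<and> C k n \<subseteq> A k) \<and>
      (AE x in completion \<mu>. x \<in> A k \<longrightarrow> x \<in> (\<Union>n. C k n))"
    by (intro bchoice ballI completion_closed_exhaustion \<mu> A)
  then obtain C where C: "\<And>k n. k \<in> {1..K} \<Longrightarrow> closed (C k n)"
      "\<And>k n. k \<in> {1..K} \<Longrightarrow> C k n \<subseteq> A k"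
      "\<And>k. k \<in> {1..K} \<Longrightarrow> AE x in completion \<mu>. x \<in> A k \<longrightarrow> x \<in> (\<Union>n::nat. C k n)"
    by blast
  have "separated K (\<lambda>k. \<Union>n\<in>UNIV. C k n)"
  proof (rule separated_UN[OF K])
    fix f :: "nat \<Rightarrow> nat"
    show "separated K (\<lambda>k. C k (f k))"
    proof (rule separated_disjoint_closed[OF M cpt K nbhd])
      show "disjoint_family_on (\<lambda>k. C k (f k)) {1..K}"
        using disj C(2) unfolding disjoint_family_on_def by blast
    qed (use C(1) in auto)
  qed simp
  then show ?thesis using C(3) by (rule separated_mono)
qed

section \<open>From zero sequence entropy to separation, and the final bound\<close>

lemma almost_periodic_zero_entropy:
  fixes G :: "('g, 'm) monoid_scheme" and \<phi> :: "'g \<Rightarrow> 'x::topological_space \<Rightarrow> 'x"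
  assumes G: "action_by_homeomorphisms G \<phi>" and \<mu>: "\<mu> \<in> invariant_measures G \<phi>"
    and \<alpha>: "\<alpha> \<in> measurable_partitions \<mu>" and zero: "\<not> max_seq_entropy_partition G \<phi> \<mu> \<alpha> > 0"
    and A: "A \<in> \<alpha>"
  shows "measure_preserving_maps.almost_periodic (completion \<mu>) \<phi> (carrier G) A"
proof -
  interpret measure_preserving_maps "completion \<mu>" \<phi> "carrier G"
    by (rule measure_preserving_maps_completion[OF G \<mu>])
  have sp: "space \<mu> = UNIV" using space_UNIV by simp
  note d = measurable_partitionsD[OF \<alpha>]
  note X = simple_function_cell[OF \<alpha> sp]
  show ?thesis
  proof (rule ccontr)
    assume nap: "\<not> almost_periodic A"
    \<comment> \<open>Excludes the one case in which the fibre of \<open>cell \<alpha>\<close> over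
      \<open>A\<close> may differ from \<open>A\<close>.\<close>
    then have "A \<noteq> {}" using almost_periodic_empty by blast
    then have "cell \<alpha> -` {A} = A" by (rule vimage_cell[OF d(2) A])
    then have "\<not> almost_periodic (cell \<alpha> -` {A})" using nap by simp
    then obtain e g where eg: "e > 0" "range g \<subseteq> carrier G"
      "\<And>n. real n * e \<le> entropy_ln (\<lambda>x. \<lambda>i\<in>{1..n}. cell \<alpha> (\<phi> (g i) x))"
      by (rule not_almost_periodic_entropy_growth[OF X]) blast
    have "ereal e \<le> seq_entropy_along \<phi> \<mu> g \<alpha>"
      unfolding seq_entropy_along_def
    proof (rule le_Limsup)
      show "\<forall>\<^sub>F n in sequentially. ereal e \<le> ereal (1 / real n *
        partition_entropy \<mu> (partition_join {1..n} (\<lambda>i. (\<lambda>A. \<phi> (g i) -` A) ` \<alpha>)))"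
        using eventually_gt_at_top[of 0]
      proof eventually_elim
        fix n :: nat assume n: "n > 0"
        have "real n * e \<le> partition_entropy \<mu> (partition_join {1..n} (\<lambda>i. (\<lambda>A. \<phi> (g i) -` A) ` \<alpha>))"
          using eg(3)[of n] eg(2)
          by (subst partition_entropy_join_orbit[OF G \<mu> \<alpha>]) auto
        then show "ereal e \<le> ereal (1 / real n *
            partition_entropy \<mu> (partition_join {1..n} (\<lambda>i. (\<lambda>A. \<phi> (g i) -` A) ` \<alpha>)))"
          using n by (simp add: pos_le_divide_eq mult.commute)
      qed
    qed simp
    also have "\<dots> \<le> max_seq_entropy_partition G \<phi> \<mu> \<alpha>"
      unfolding max_seq_entropy_partition_def using eg(2) by (intro SUP_upper) simp
    finally have "ereal e \<le> max_seq_entropy_partition G \<phi> \<mu> \<alpha>" .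
    moreover have "0 < ereal e" using eg(1) by simp
    ultimately show False using zero by (meson less_le_trans)
  qed
qed

text \<open>Each member of \<alpha> is assigned to one coordinate whose point avoids its closure.
  The members assigned to \<open>j\<close> unite to \<open>E j\<close>, and removing their closures
  leaves the open set \<open>U j\<close>.\<close>

lemma separated_neighbourhoods:
  fixes G :: "('g, 'm) monoid_scheme" and \<phi> :: "'g \<Rightarrow> 'x::topological_space \<Rightarrow> 'x"
  assumes G: "action_by_homeomorphisms G \<phi>" and \<mu>: "\<mu> \<in> invariant_measures G \<phi>"
    and adm: "admissible \<mu> K x \<alpha>" and zero: "\<not> max_seq_entropy_partition G \<phi> \<mu> \<alpha> > 0"
  shows "\<exists>U. (\<forall>k\<in>{1..K}. open (U k) \<and> x k \<in> U k) \<and>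
    measure_preserving_maps.separated (completion \<mu>) \<phi> (carrier G) K U"
proof -
  interpret measure_preserving_maps "completion \<mu>" \<phi> "carrier G"
    by (rule measure_preserving_maps_completion[OF G \<mu>])
  have \<alpha>: "\<alpha> \<in> measurable_partitions \<mu>" using adm by (simp add: admissible_def)
  note d = measurable_partitionsD[OF \<alpha>]
  have "\<forall>A\<in>\<alpha>. \<exists>k. k \<in> {1..K} \<and> x k \<notin> closure A"
    using adm unfolding admissible_def by blast
  then obtain k where k: "\<And>A. A \<in> \<alpha> \<Longrightarrow> k A \<in> {1..K}" "\<And>A. A \<in> \<alpha> \<Longrightarrow> x (k A) \<notin> closure A"
    by metis
  define U where "U j = - (\<Union>A\<in>{A \<in> \<alpha>. k A = j}. closure A)" for j
  define E where "E j = (\<Union>A\<in>{A \<in> \<alpha>. k A = j}. A)" for j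
  have "open (U j)" for j
    unfolding U_def using d(1) by (intro open_Compl closed_UN) auto
  moreover have "x j \<in> U j" for j unfolding U_def using k(2) by auto
  moreover have "separated K U"
  proof (rule separatedI[of K E])
    fix j
    show "almost_periodic (E j)"
      unfolding E_def using d(1)
      by (intro almost_periodic_countable_UN almost_periodic_zero_entropy[OF G \<mu> \<alpha> zero])
        (auto intro: countable_finite)
    have "U j \<inter> E j = {}" unfolding U_def E_def using closure_subset by blast
    then show "AE z in completion \<mu>. z \<notin> U j \<or> z \<notin> E j" by auto
  next
    have "- \<Union>\<alpha> \<in> null_sets (completion \<mu>)"
      using \<mu> space_UNIV by (intro prob_Compl_Union_partition \<alpha>) (auto simp: invariant_measures_def)
    then have "AE z in completion \<mu>. z \<notin> - \<Union>\<alpha>" by (rule AE_not_in)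
    then show "AE z in completion \<mu>. \<exists>j\<in>{1..K}. z \<in> E j"
      by (rule eventually_mono) (use k(1) in \<open>auto simp: E_def\<close>)
  qed
  ultimately show ?thesis by blast
qed

theorem theorem1p3:
  fixes G :: "('g, 'm) monoid_scheme"
    and \<phi> :: "'g \<Rightarrow> 'x::metric_space \<Rightarrow> 'x"
    and \<mu> :: "'x measure"
    and K :: nat
  assumes "group G"
    and "countable (carrier G)"
    and "infinite (carrier G)"
    and "compact (UNIV :: 'x set)"
    and "action_by_homeomorphisms G \<phi>"
    and "\<mu> \<in> invariant_measures G \<phi>"
    and "K \<ge> 2"
    and "\<not> (\<exists>x. seq_entropy_tuple G \<phi> \<mu> K x \<and> essential_tuple K x)"
  shows "max_seq_entropy G \<phi> \<mu> \<le> ereal (ln (real (K - 1)))"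
proof -
  note G = assms(5) and \<mu> = assms(6)
  note M = measure_preserving_maps_completion[OF G \<mu>]
  interpret measure_preserving_maps "completion \<mu>" \<phi> "carrier G" by (rule M)
  have P: "prob_space \<mu>" "sets \<mu> = sets borel" using \<mu> by (auto simp: invariant_measures_def)
  have sp: "space \<mu> = UNIV" using space_UNIV by simp
  have K: "K \<ge> 1" using assms(7) by simp
  have nbhd: "\<exists>U. (\<forall>k\<in>{1..K}. open (U k) \<and> x k \<in> U k) \<and> separated K U"
    if inj: "inj_on x {1..K}" for x :: "nat \<Rightarrow> 'x"
  proof -
    define y where "y = restrict x {1..K}"
    have yx: "y k = x k" if "k \<in> {1..K}" for k using that by (simp add: y_def)
    have ne: "y i \<noteq> y j" if "1 \<le> i" "i < j" "j \<le> K" for i j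
      using inj_onD[OF inj, of i j] that yx[of i] yx[of j] by auto
    then have ess: "essential_tuple K y" by (simp add: essential_tuple_def)
    have "y \<in> tuples K" by (simp add: y_def tuples_def)
    \<comment> \<open>As \<open>K\<close> is at least 2, the entries 1 and 2 exist, and they
      differ.\<close>
    moreover have "y \<notin> diagonal_tuples K"
      using ne[of 1 2] assms(7) by (auto simp: diagonal_tuples_def)
    ultimately obtain \<alpha> where "admissible \<mu> K y \<alpha>" "\<not> max_seq_entropy_partition G \<phi> \<mu> \<alpha> > 0"
      using assms(8) ess unfolding seq_entropy_tuple_def by blast
    from separated_neighbourhoods[OF G \<mu> this] show ?thesis using yx by simp
  qed
  have "seq_entropy_along \<phi> \<mu> g \<alpha> \<le> ereal (ln (real (K - 1)))"
    if \<alpha>: "\<alpha> \<in> measurable_partitions \<mu>" and g: "range g \<subseteq> carrier G" for \<alpha> g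
  proof -
    note X = simple_function_cell[OF \<alpha> sp]
    \<comment> \<open>Fibres over distinct values are disjoint. The value \<open>{}\<close>, whose
      fibre is the null remainder, is treated like any other.\<close>
    have sep: "separated K (\<lambda>k. cell \<alpha> -` {u k})" if u: "inj_on u {1..K}" for u
    proof (rule separated_disjoint[OF M P assms(4) K nbhd])
      show "cell \<alpha> -` {u k} \<in> events" for k
        using simple_functionD(2)[OF X, of "{u k}"] by (simp add: sp)
      show "disjoint_family_on (\<lambda>k. cell \<alpha> -` {u k}) {1..K}"
        unfolding disjoint_family_on_def
      proof (intro ballI impI)
        fix i j assume "i \<in> {1..K}" "j \<in> {1..K}" "i \<noteq> j"
        then have "u i \<noteq> u j" using inj_onD[OF u] by metis
        then show "cell \<alpha> -` {u i} \<inter> cell \<alpha> -` {u j} = {}" by auto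
      qed
    qed
    obtain J :: "((nat \<Rightarrow> 'x set) \<times> nat) set" and B where
      J: "finite J" "\<And>j. j \<in> J \<Longrightarrow> almost_periodic (B j)"
      "\<And>s. card {u \<in> range (cell \<alpha>). prob (cell \<alpha> -` {u} \<inter> {x. (\<lambda>j\<in>J. x \<in> B j) = s}) > 0} \<le> K - 1"
      by (rule separated_fibres_pattern[OF X K sep]) blast+
    show ?thesis
    proof (rule ereal_le_epsilon2)
      fix e :: real assume e: "e > 0"
      have K1: "K - 1 > 0" using assms(7) by simp
      \<comment> \<open>One half of the slack is spent on the growth of the almost periodic part,
        the other absorbs \<open>c\<close>, which becomes negligible after division by
        \<open>n\<close>.\<close>
      have e2: "e / 2 > 0" using e by simp
      obtain c where c: "\<And>(I :: nat set) g. finite I \<Longrightarrow> g ` I \<subseteq> carrier G \<Longrightarrow>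
          entropy_ln (\<lambda>x. \<lambda>i\<in>I. cell \<alpha> (\<phi> (g i) x)) \<le> c + real (card I) * (ln (real (K - 1)) + e / 2)"
        by (rule entropy_growth_le_log_card[OF X J(1,2) K1 J(3) e2]) blast+
      have "(\<lambda>n. c / real n) \<longlonglongrightarrow> 0" by (rule lim_const_over_n)
      then have "\<forall>\<^sub>F n in sequentially. c / real n < e / 2" using e2 by (rule order_tendstoD(2))
      then have "\<forall>\<^sub>F n in sequentially. ereal (1 / real n *
          partition_entropy \<mu> (partition_join {1..n} (\<lambda>i. (\<lambda>A. \<phi> (g i) -` A) ` \<alpha>)))
          \<le> ereal (ln (real (K - 1)) + e)"
        using eventually_gt_at_top[of 0]
      proof eventually_elim
        fix n :: nat assume n: "c / real n < e / 2" "n > 0"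
        have gn: "g ` {1..n} \<subseteq> carrier G" using g by auto
        have "partition_entropy \<mu> (partition_join {1..n} (\<lambda>i. (\<lambda>A. \<phi> (g i) -` A) ` \<alpha>))
            \<le> c + real n * (ln (real (K - 1)) + e / 2)"
          using c[OF finite_atLeastAtMost gn]
          by (subst partition_entropy_join_orbit[OF G \<mu> \<alpha> gn]) auto
        then have "1 / real n * partition_entropy \<mu> (partition_join {1..n} (\<lambda>i. (\<lambda>A. \<phi> (g i) -` A) ` \<alpha>))
            \<le> 1 / real n * (c + real n * (ln (real (K - 1)) + e / 2))"
          by (intro mult_left_mono) auto
        also have "\<dots> = c / real n + (ln (real (K - 1)) + e / 2)"
          using n(2) by (simp add: field_simps)
        also have "\<dots> \<le> ln (real (K - 1)) + e" using n(1) by linarith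
        finally show "ereal (1 / real n *
            partition_entropy \<mu> (partition_join {1..n} (\<lambda>i. (\<lambda>A. \<phi> (g i) -` A) ` \<alpha>)))
            \<le> ereal (ln (real (K - 1)) + e)"
          by (simp only: ereal_less_eq)
      qed
      then show "seq_entropy_along \<phi> \<mu> g \<alpha> \<le> ereal (ln (real (K - 1))) + ereal e"
        unfolding seq_entropy_along_def by (intro Limsup_bounded) simp
    qed
  qed
  then show ?thesis
    unfolding max_seq_entropy_def max_seq_entropy_partition_def by (intro SUP_least) simp
qed

end
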